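(* Let $p$ be an odd prime, $n$ an odd positive integer, $v=v_p(n)$, and write $x^n-1=(x-1)^{p^{v}}r_{1}^{p^{v}}\cdots r_{k}^{p^{v}}$ in $\mathbb{F}_p[x]$ with $r_1,\dots,r_k$ distinct monic prime self-reciprocal polynomials (necessarily of even degree). Then \[ \mathcal{G}^{(p)}_{n}(z)=\sum_{t=0}^n\mathcal{N}^{(p)}_n(n-t)z^t=\left(1+\sum_{j=1}^{\frac{p^{v}+1}{2}}p^{j-1}(p-1)z^{2j-1}\right)\prod_{i=1}^{k}G_i(z), \] where \[ G_i(z)=1+\sum_{j=1}^{p^{v}}\left(p^{\frac{\deg(r_i^{j})}{2}}-p^{\frac{\deg(r_i^{j})-\deg(r_i)}{2}}\right)z^{j\deg(r_i)}. \]
   Context: $\mathrm{Tr}_n:\mathbb{F}_{p^n}\to\mathbb{F}_p$ is the absolute trace, $\epsilon_p=e^{2\pi i/p}$. The Walsh transform of $f:\mathbb{F}_{p^n}\to\mathbb{F}_p$ is $\widehat f(b)=\sum_{x}\epsilon_p^{f(x)-\mathrm{Tr}_n(bx)}$; for an integer $0\le s\le n$, $f$ is $s$-plateaued if $|\widehat f(b)|\in\{0,p^{(n+s)/2}\}$ for all $b$. $\mathcal{D}$ is the set of functions $Q(x)=\mathrm{Tr}_n\big(\sum_{i=0}^{\lfloor n/2\rfloor}a_ix^{p^i+1}\big)$, $a_i\in\mathbb{F}_p$, including the zero function ($n$-plateaued); $\mathcal{N}^{(p)}_n(s)$ is the number of tuples $(a_0,\dots,a_{\lfloor n/2\rfloor})\in\mathbb{F}_p^{\lfloor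 n/2\rfloor+1}$ for which $Q$ is $s$-plateaued. For $f\in\mathbb{F}_p[x]$ with $f(0)\ne0$, $f^*(x)=x^{\deg f}f(1/x)$; $f$ is self-reciprocal if $f^*=f$. A monic $f$ is prime self-reciprocal if either $f$ is irreducible and self-reciprocal, or $f=ugg^*$ with $g$ monic irreducible, $g^*$ not a constant multiple of $g$, $u\in\mathbb{F}_p^*$. *)

theory Defs
  imports
    Complex_Main
    "HOL-Library.FuncSet"
    "HOL-Computational_Algebra.Computational_Algebra"
    "Berlekamp_Zassenhaus.Finite_Field"
begin

text \<open>
  The prime field \<open>F\<^sub>p\<close> is \<open>'p mod_ring\<close> with \<open>p = CARD('p)\<close>; the extension \<open>F\<^sub>q\<close>, \<open>q = p ^ n\<close>, is
  any finite field \<open>'k\<close> with \<open>CARD('k) = p ^ n\<close>. Definitions depending on \<open>n\<close> take it as an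
  argument and are meaningful only under this cardinality condition, which forces \<open>'k\<close> to have
  characteristic \<open>p\<close>.
\<close>

text \<open>If \<open>'k\<close> has characteristic \<open>p\<close>, this is the unique field embedding.\<close>

definition embed :: "'p::prime_card mod_ring \<Rightarrow> 'k::field" where
  "embed c = of_int (to_int_mod_ring c)"

text \<open>The sum of conjugates lies in the image of \<^const>\<open>embed\<close>; the trace is its unique preimage.\<close>

definition abs_trace :: "nat \<Rightarrow> 'k::field \<Rightarrow> 'p::prime_card mod_ring" where
  "abs_trace n x = (THE c. embed c = (\<Sum>i<n. x ^ (CARD('p) ^ i)))"

definition walsh ::
  "nat \<Rightarrow> ('k::{field,finite} \<Rightarrow> 'p::prime_card mod_ring) \<Rightarrow> 'k \<Rightarrow> complex" where
  "walsh n f b =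
     (\<Sum>x\<in>UNIV. exp (2 * of_real pi * \<i> / of_nat CARD('p))
                 powi to_int_mod_ring (f x - abs_trace n (b * x)))"

definition plateaued ::
  "nat \<Rightarrow> nat \<Rightarrow> ('k::{field,finite} \<Rightarrow> 'p::prime_card mod_ring) \<Rightarrow> bool" where
  "plateaued n s f \<longleftrightarrow>
     s \<le> n \<and> (\<forall>b. cmod (walsh n f b) \<in> {0, real CARD('p) powr ((real n + real s) / 2)})"

definition quad_fun ::
  "nat \<Rightarrow> (nat \<Rightarrow> 'p::prime_card mod_ring) \<Rightarrow> 'k::field \<Rightarrow> 'p mod_ring" where
  "quad_fun n a x = abs_trace n (\<Sum>i=0..n div 2. embed (a i) * x ^ (CARD('p) ^ i + 1))"

text \<open>Tuples \<open>(a\<^sub>0, \<dots>)\<close> are extensional functions on \<open>{0..n div 2}\<close>.\<close>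

definition num_plateaued ::
  "'p::prime_card itself \<Rightarrow> 'k::{field,finite} itself \<Rightarrow> nat \<Rightarrow> nat \<Rightarrow> nat" where
  "num_plateaued _ _ n s =
     card {a \<in> {0..n div 2} \<rightarrow>\<^sub>E (UNIV :: 'p mod_ring set).
             plateaued n s (quad_fun n a :: 'k \<Rightarrow> 'p mod_ring)}"

text \<open>For \<open>f(0) \<noteq> 0\<close>, \<^const>\<open>reflect_poly\<close> is the reciprocal polynomial \<open>x ^ deg f * f(1/x)\<close>.\<close>

definition self_reciprocal :: "'a::field poly \<Rightarrow> bool" where
  "self_reciprocal f \<longleftrightarrow> poly f 0 \<noteq> 0 \<and> reflect_poly f = f"

definition prime_self_reciprocal :: "'a::field poly \<Rightarrow> bool" where
  "prime_self_reciprocal f \<longleftrightarrow>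
     lead_coeff f = 1 \<and>
     (Factorial_Ring.irreducible f \<and> self_reciprocal f \<or>
      (\<exists>u g. u \<noteq> 0 \<and> lead_coeff g = 1 \<and> Factorial_Ring.irreducible g \<and> poly g 0 \<noteq> 0 \<and>
             \<not> (\<exists>c. reflect_poly g = Polynomial.smult c g) \<and>
             f = Polynomial.smult u (g * reflect_poly g)))"

end

theory Submission
  imports Defs "HOL-Number_Theory.Cong"
begin

hide_const (open) up_ring.monom up_ring.coeff Module.smult

text \<open>
  The squared Walsh transform of \<open>Q\<close> is \<open>p\<^sup>n\<close> times a character sum over the kernel of the
  linearised polynomial \<open>L(z) = \<Sum> a\<^sub>i (z ^ (p ^ i) + z ^ (p ^ (n - i)))\<close>, on which \<open>Q\<close> vanishes since
  \<open>p\<close> is odd; hence \<open>Q\<close> is \<open>s\<close>-plateaued iff this kernel has \<open>p\<^sup>s\<close> elements. As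
  \<open>L = A(Frobenius)\<close> for \<open>A = \<Sum> a\<^sub>i (x\<^sup>i + x\<^sup>-\<^sup>i)\<close> in \<open>R = F\<^sub>p[x]/(x\<^sup>n - 1)\<close>, the exponent is
  \<open>s = deg gcd(A, x\<^sup>n - 1)\<close>, and \<open>A\<close> runs exactly once through the elements of \<open>R\<close> fixed by
  \<open>x \<mapsto> x\<^sup>-\<^sup>1\<close>. The enumeration of fixed elements by \<open>n - deg gcd\<close> is multiplicative by the Chinese
  remainder theorem, because the involution respects the factors \<open>(x - 1) ^ (p ^ v)\<close> and
  \<open>r\<^sub>i ^ (p ^ v)\<close>. Within a factor \<open>M\<close>, multiplication by antisymmetric elements such as
  \<open>x - x\<^sup>-\<^sup>1\<close> relates symmetric and antisymmetric residues, and the product of their numbers is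
  \<open>p ^ deg M\<close>.
\<close>

section \<open>The involution of \<open>F[x]/(x\<^sup>n - 1)\<close>\<close>

definition cyc :: "nat \<Rightarrow> 'a::field_gcd poly" where
  "cyc n = monom 1 n - 1"

text \<open>Modulo \<open>x\<^sup>n - 1\<close> this is the involution \<open>x \<mapsto> x\<^sup>-\<^sup>1\<close>, since \<open>x\<^sup>-\<^sup>1 = x\<^sup>n\<^sup>-\<^sup>1\<close>.\<close>

definition recip :: "nat \<Rightarrow> 'a::field_gcd poly \<Rightarrow> 'a poly" where
  "recip n A = pcompose A (monom 1 (n - 1))"

lemma recip_add [simp]: "recip n (A + B) = recip n A + recip n B"
  and recip_diff [simp]: "recip n (A - B) = recip n A - recip n B"
  and recip_uminus [simp]: "recip n (- A) = - recip n A"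
  and recip_mult [simp]: "recip n (A * B) = recip n A * recip n B"
  and recip_0 [simp]: "recip n 0 = 0"
  and recip_1 [simp]: "recip n 1 = 1"
  and recip_smult [simp]: "recip n (smult c A) = smult c (recip n A)"
  by (simp_all add: recip_def pcompose_add pcompose_diff pcompose_uminus pcompose_mult pcompose_1
      pcompose_smult)

lemma recip_power [simp]: "recip n (A ^ k) = recip n A ^ k"
  by (induction k) simp_all

lemma recip_sum [simp]: "recip n (sum f S) = (\<Sum>i\<in>S. recip n (f i))"
  by (simp add: recip_def pcompose_sum)

lemma recip_monom [simp]: "recip n (monom c k) = monom c ((n - 1) * k)"
proof -
  have "monom c k = smult c (monom 1 1 ^ k)"
    by (simp add: monom_power smult_monom)
  moreover have "recip n (monom (1::'a) 1) = monom 1 (n - 1)"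
    by (simp add: recip_def monom_Suc pcompose_pCons monom_0)
  ultimately have "recip n (monom c k) = smult c (monom 1 (n - 1) ^ k)"
    by (simp only: recip_smult recip_power)
  thus ?thesis
    by (simp add: monom_power smult_monom)
qed

lemma degree_cyc:
  assumes "n > 0"
  shows "degree (cyc n :: 'a::field_gcd poly) = n"
proof -
  have "degree (monom (1::'a) n + (- 1)) = degree (monom (1::'a) n)"
    using assms by (intro degree_add_eq_left) (simp add: degree_monom_eq)
  thus ?thesis by (simp add: cyc_def degree_monom_eq)
qed

lemma cyc_nz: "n > 0 \<Longrightarrow> cyc n \<noteq> (0 :: 'a::field_gcd poly)"
  by (metis degree_0 degree_cyc less_irrefl)

text \<open>As x^n is 1 modulo \<open>cyc n\<close>, an exponent may be shifted by any multiple of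
  n.\<close>

lemma cong_monom:
  assumes "[i = j] (mod n)"
  shows "[monom c i = monom (c::'a::field_gcd) j] (mod cyc n)"
proof -
  have 1: "[monom 1 n = (1 :: 'a poly)] (mod cyc n)"
    by (simp add: cong_iff_dvd_diff cyc_def)
  have *: "[monom c (j + k * n) = monom c j] (mod cyc n)" for j k
  proof -
    have "monom c (j + k * n) = monom c j * monom 1 n ^ k"
      by (simp add: monom_power mult_monom mult.commute)
    also have "[\<dots> = monom c j * 1 ^ k] (mod cyc n)"
      by (intro cong_mult cong_pow cong_refl 1)
    finally show ?thesis by simp
  qed
  have "\<exists>k1 k2. j + k1 * n = i + k2 * n"
    using assms by (metis cong_iff_lin_nat)
  then obtain k1 k2 where "j + k1 * n = i + k2 * n" by blast
  hence "[monom c j = monom c (i + k2 * n)] (mod cyc n)"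
    using cong_sym[OF *[of j k1]] by simp
  from cong_trans[OF this *] show ?thesis by (rule cong_sym)
qed

lemma recip_recip:
  assumes "n > 0"
  shows "[recip n (recip n A) = A] (mod cyc n)"
proof -
  have A: "A = (\<Sum>i\<le>degree A. monom (coeff A i) i)"
    by (simp add: poly_as_sum_of_monoms)
  have "recip n (recip n A) = (\<Sum>i\<le>degree A. monom (coeff A i) ((n - 1) * ((n - 1) * i)))"
    by (subst A) simp
  also have "[\<dots> = (\<Sum>i\<le>degree A. monom (coeff A i) i)] (mod cyc n)"
  proof (intro cong_sum cong_monom)
    fix i
    obtain m where n: "n = Suc m" using assms by (cases n) auto
    \<comment> \<open>With m = n - 1 this is (n - 1)^2 = 1 - 2n + n^2 times i, rearranged to avoid
      subtraction of naturals.\<close>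
    have "m * (m * i) + n * (2 * i) = i + n * (n * i)"
      by (simp add: n algebra_simps)
    thus "[(n - 1) * ((n - 1) * i) = i] (mod n)"
      using n by (metis cong_iff_lin_nat diff_Suc_1 mult.commute)
  qed
  finally show ?thesis using A by simp
qed

text \<open>Bridge between the involution and reflection: \<open>recip n f\<close> is f(x^-1), which
  becomes the reciprocal polynomial after clearing denominators.\<close>

lemma recip_reflect:
  assumes "n > 0"
  shows "[monom 1 (degree f) * recip n f = reflect_poly f] (mod cyc n)"
proof -
  have A: "f = (\<Sum>i\<le>degree f. monom (coeff f i) i)"
    by (simp add: poly_as_sum_of_monoms)
  have "monom 1 (degree f) * recip n f = (\<Sum>i\<le>degree f. monom (coeff f i) (degree f + (n - 1) * i))"
    by (subst (2) A) (simp add: sum_distrib_left mult_monom)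
  also have "[\<dots> = (\<Sum>i\<le>degree f. monom (coeff f i) (degree f - i))] (mod cyc n)"
  proof (intro cong_sum cong_monom)
    fix i assume "i \<in> {..degree f}"
    moreover obtain m where n: "n = Suc m" using assms by (cases n) auto
    ultimately have "degree f + (n - 1) * i = (degree f - i) + i * n"
      by (simp add: algebra_simps)
    thus "[degree f + (n - 1) * i = degree f - i] (mod n)"
      by (simp add: cong_def)
  qed
  also have "(\<Sum>i\<le>degree f. monom (coeff f i) (degree f - i)) = reflect_poly f"
  proof -
    have "(\<Sum>i\<le>degree f. monom (coeff f i) (degree f - i))
        = (\<Sum>i\<le>degree f. monom (coeff f (degree f - i)) i)"
      by (rule sum.reindex_bij_witness[of _ "\<lambda>i. degree f - i" "\<lambda>i. degree f - i"]) auto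
    also have "\<dots> = (\<Sum>i\<le>degree f. monom (coeff (reflect_poly f) i) i)"
      by (intro sum.cong) (auto simp: coeff_reflect_poly)
    also have "\<dots> = reflect_poly f"
      by (rule poly_as_sum_of_monoms') (rule degree_reflect_poly_le)
    finally show ?thesis .
  qed
  finally show ?thesis .
qed

text \<open>Modulo \<open>cyc n\<close>, x has the inverse x^(n-1), so powers of x are units modulo
  each divisor and can be cancelled.\<close>

lemma coprime_monom:
  assumes "M dvd cyc n" "n > 0"
  shows "coprime (monom (1::'a::field_gcd) l) M"
proof -
  have "[monom (1::'a) (l * n) = monom 1 0] (mod M)"
    by (rule cong_dvd_modulus[OF cong_monom assms(1)]) (simp add: cong_def)
  moreover have "monom (1::'a) (l * n) = monom 1 l * monom 1 (l * (n - 1))"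
    using assms(2) by (cases n) (simp_all add: mult_monom)
  ultimately have "[monom (1::'a) l * monom 1 (l * (n - 1)) = 1] (mod M)"
    by simp
  hence "[1 = monom (1::'a) l * monom 1 (l * (n - 1))] (mod M)"
    by (rule cong_sym)
  hence "coprime (monom (1::'a) l * monom 1 (l * (n - 1))) M"
    by (rule cong_imp_coprime) simp
  thus ?thesis by simp
qed

text \<open>Sign 1 is self-reciprocity; sign -1 is needed for x - 1 and x^2 - 1. The form
  \<open>c * c = 1\<close> lets signs multiply and makes c its own inverse.\<close>

definition refl_sign :: "'a::field_gcd \<Rightarrow> 'a poly \<Rightarrow> bool" where
  "refl_sign c f \<longleftrightarrow> c * c = 1 \<and> reflect_poly f = smult c f"

lemma refl_sign_mult:
  assumes "refl_sign c f" "refl_sign d g"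
  shows "refl_sign (c * d) (f * g)"
proof -
  have "(c * d) * (c * d) = (c * c) * (d * d)"
    by (simp only: mult_ac)
  also have "\<dots> = 1"
    using assms by (simp add: refl_sign_def)
  finally show ?thesis
    using assms by (simp add: refl_sign_def reflect_poly_mult mult.commute[of d c])
qed

lemma refl_sign_1 [simp]: "refl_sign 1 1"
  by (simp add: refl_sign_def)

lemma refl_sign_power: "refl_sign c f \<Longrightarrow> refl_sign (c ^ k) (f ^ k)"
  by (induction k) (simp_all add: refl_sign_mult)

text \<open>The second condition says that the ideal (M) is stable, so that the involution descends
  to F[x]/(M).\<close>

definition inv_stable :: "nat \<Rightarrow> 'a::field_gcd poly \<Rightarrow> bool" where
  "inv_stable n M \<longleftrightarrow> M dvd cyc n \<and> M dvd recip n M"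

lemma inv_stable_nz: "inv_stable n M \<Longrightarrow> n > 0 \<Longrightarrow> M \<noteq> 0"
  using cyc_nz by (auto simp: inv_stable_def dest!: dvd_0_left)

lemma recip_cong:
  assumes "M dvd recip n M" "[A = B] (mod M)"
  shows "[recip n A = recip n B] (mod M)"
proof -
  have "M dvd A - B" using assms(2) by (simp add: cong_iff_dvd_diff)
  then obtain k where "A - B = M * k" by (rule dvdE)
  hence "recip n A - recip n B = recip n M * recip n k"
    by (metis recip_diff recip_mult)
  thus ?thesis using assms(1) by (simp add: cong_iff_dvd_diff)
qed

text \<open>Modulo M, x^(deg M) times \<open>recip n M\<close> is \<open>smult c M\<close>, hence 0,
  and the power of x is a unit.\<close>

lemma inv_stable_refl_sign:
  assumes "refl_sign c M" "M dvd cyc n" "n > 0"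
  shows "inv_stable n M"
proof -
  have "[monom 1 (degree M) * recip n M = smult c M] (mod M)"
    using cong_dvd_modulus[OF recip_reflect[OF assms(3), of M] assms(2)] assms(1)
    by (simp add: refl_sign_def)
  from cong_dvd_iff[OF this] have "M dvd monom 1 (degree M) * recip n M"
    by (simp add: dvd_smult)
  moreover have "coprime M (monom 1 (degree M))"
    using coprime_monom[OF assms(2,3)] by (simp add: coprime_commute)
  ultimately show ?thesis
    using assms(2) by (simp add: inv_stable_def coprime_dvd_mult_right_iff)
qed

text \<open>Normalising a reciprocal polynomial by a half-integral power of \<open>x\<close>; since \<open>n\<close> is odd, \<open>2\<close>
  is invertible modulo \<open>n\<close>, and \<open>(n - 1) div 2\<close> plays the role of the exponent \<open>- 1 / 2\<close>.\<close>

lemma refl_sign_half: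
  assumes "refl_sign c f" "odd n"
  defines "w \<equiv> monom 1 (degree f * ((n - 1) div 2)) * f"
  shows "[recip n w = smult c w] (mod cyc n)"
proof -
  obtain m where n: "n = Suc (2 * m)" using assms(2) by (auto elim!: oddE)
  have n0: "n > 0" using n by simp
  have "recip n w = monom 1 (2 * m * (degree f * m)) * recip n f"
    by (simp add: w_def n)
  also have "[monom 1 (2 * m * (degree f * m)) * recip n f =
      monom 1 (degree f * m + degree f) * recip n f] (mod cyc n)"
  proof (intro cong_scalar_right cong_monom)
    show "[2 * m * (degree f * m) = degree f * m + degree f] (mod n)"
    proof -
      \<comment> \<open>Since n = 2m + 1, modulo n one has 2m = -1 and -m = m + 1; multiples of n
        are added to stay within the naturals.\<close>
      have "2 * m * (degree f * m) + degree f * n = degree f * m + degree f + (degree f * m) * n"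
        by (simp add: n algebra_simps)
      thus ?thesis by (metis cong_iff_lin_nat)
    qed
  qed
  also have "monom 1 (degree f * m + degree f) * recip n f = monom 1 (degree f * m) * (monom 1 (degree f) * recip n f)"
    by (simp add: mult_monom flip: mult.assoc)
  also have "[monom 1 (degree f * m) * (monom 1 (degree f) * recip n f)
        = monom 1 (degree f * m) * reflect_poly f] (mod cyc n)"
    by (intro cong_scalar_left recip_reflect n0)
  also have "monom 1 (degree f * m) * reflect_poly f = smult c w"
    using assms(1) by (simp add: w_def n refl_sign_def)
  finally show ?thesis .
qed

section \<open>Symmetric and antisymmetric residues\<close>

lemma residue_iff:
  fixes A M :: "'a::field_gcd poly"
  assumes "M \<noteq> 0"
  shows "A mod M = A \<longleftrightarrow> (\<forall>i\<ge>degree M. coeff A i = 0)"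
proof
  assume "A mod M = A"
  thus "\<forall>i\<ge>degree M. coeff A i = 0"
    using degree_mod_less[OF assms, of A] by (metis coeff_0 coeff_eq_0 order_less_le_trans)
next
  assume "\<forall>i\<ge>degree M. coeff A i = 0"
  hence "A = 0 \<or> degree A < degree M"
    by (metis leading_coeff_0_iff linorder_not_less)
  thus "A mod M = A" by (auto simp: mod_poly_less)
qed

lemma card_residues:
  assumes "M \<noteq> 0"
  shows "finite {A. A mod M = (A :: 'a::{field_gcd,finite} poly)}"
    and "card {A. A mod M = (A :: 'a poly)} = CARD('a) ^ degree M"
proof -
  let ?d = "degree M"
  let ?f = "\<lambda>a. \<Sum>i<?d. monom (a i :: 'a) i"
  note res = residue_iff[OF assms]
  have co: "coeff (?f a) j = (if j < ?d then a j else 0)" for a j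
    by (simp add: coeff_sum)
  have "bij_betw ?f ({..<?d} \<rightarrow>\<^sub>E UNIV) {A. A mod M = A}"
  proof (rule bij_betwI[where g = "\<lambda>A. restrict (coeff A) {..<?d}"])
    show "?f \<in> ({..<?d} \<rightarrow>\<^sub>E UNIV) \<rightarrow> {A. A mod M = A}"
      by (auto simp: res co)
    show "(\<lambda>A. restrict (coeff A) {..<?d}) \<in> {A. A mod M = A} \<rightarrow> {..<?d} \<rightarrow>\<^sub>E UNIV"
      by auto
    show "restrict (coeff (?f a)) {..<?d} = a" if "a \<in> {..<?d} \<rightarrow>\<^sub>E UNIV" for a
    proof
      fix i show "restrict (coeff (?f a)) {..<?d} i = a i"
        using PiE_arb[OF that, of i] by (simp add: co restrict_def)
    qed
    show "?f (restrict (coeff A) {..<?d}) = A" if "A \<in> {A. A mod M = A}" for A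
      using that by (intro poly_eqI) (auto simp: co res)
  qed
  moreover have "finite ({..<?d} \<rightarrow>\<^sub>E (UNIV :: 'a set))"
    by (intro finite_PiE) auto
  moreover have "card ({..<?d} \<rightarrow>\<^sub>E (UNIV :: 'a set)) = CARD('a) ^ ?d"
    by (simp add: card_PiE)
  ultimately show "finite {A. A mod M = (A :: 'a poly)}"
    "card {A. A mod M = (A :: 'a poly)} = CARD('a) ^ ?d"
    by (simp_all add: bij_betw_finite flip: bij_betw_same_card)
qed

text \<open>Canonical representatives of the eigenspace for c of the involution on F[x]/(M):
  symmetric residues for c = 1, antisymmetric ones for c = -1.\<close>

definition sym_res :: "nat \<Rightarrow> 'a::field_gcd \<Rightarrow> 'a poly \<Rightarrow> 'a poly set" where
  "sym_res n c M = {A. A mod M = A \<and> [recip n A = smult c A] (mod M)}"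

lemma finite_sym_res: "M \<noteq> 0 \<Longrightarrow> finite (sym_res n c (M :: 'a::{field_gcd,finite} poly))"
  by (rule finite_subset[OF _ card_residues(1)]) (auto simp: sym_res_def)

lemma smult_cong: "[A = B] (mod M) \<Longrightarrow> [smult c A = smult c B] (mod (M :: 'a::field_gcd poly))"
  using cong_scalar_left[of A B M "[:c:]"] by simp

lemma residue_unique: "[A = B] (mod M) \<Longrightarrow> A mod M = A \<Longrightarrow> B mod M = B \<Longrightarrow> A = (B :: 'a::field_gcd poly)"
  by (simp add: cong_def)

text \<open>Since \<open>2\<close> is invertible, the residues modulo \<open>M\<close> are the direct sum of the symmetric and
  the antisymmetric ones.\<close>

lemma card_sym_antisym:
  fixes M :: "'a::{field_gcd,finite} poly"
  assumes "inv_stable n M" "n > 0" "(2::'a) \<noteq> 0"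
  shows "card (sym_res n 1 M) * card (sym_res n (-1) M) = CARD('a) ^ degree M"
proof -
  have M: "M \<noteq> 0" "M dvd recip n M" "M dvd cyc n"
    using inv_stable_nz assms by (auto simp: inv_stable_def)
  let ?f = "\<lambda>(A, B). A + B :: 'a poly"
  have half: "smult (1/2) A + smult (1/2) A = A" for A :: "'a poly"
    using assms(3) by (simp flip: smult_add_left)
  have rr: "[recip n (recip n A) = A] (mod M)" for A
    using cong_dvd_modulus[OF recip_recip[OF assms(2)] M(3)] .
  have rmod: "[recip n (A mod M) = recip n A] (mod M)" for A
    by (rule recip_cong[OF M(2)]) simp
  have "bij_betw ?f (sym_res n 1 M \<times> sym_res n (-1) M) {A. A mod M = A}"
  proof (rule bij_betwI')
    fix x y assume "x \<in> sym_res n 1 M \<times> sym_res n (-1) M" "y \<in> sym_res n 1 M \<times> sym_res n (-1) M"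
    then obtain A B A' B' where xy: "x = (A, B)" "y = (A', B')"
      and *: "A mod M = A" "B mod M = B" "A' mod M = A'" "B' mod M = B'"
      "[recip n A = A] (mod M)" "[recip n A' = A'] (mod M)"
      "[recip n B = - B] (mod M)" "[recip n B' = - B'] (mod M)"
      by (auto simp: sym_res_def)
    have "A = A' \<and> B = B'" if e: "A + B = A' + B'"
    proof -
      have "recip n A + recip n B = recip n A' + recip n B'"
        using arg_cong[OF e, of "recip n"] by simp
      moreover have "[recip n A + recip n B = A + - B] (mod M)"
        "[recip n A' + recip n B' = A' + - B'] (mod M)"
        by (intro cong_add * )+
      ultimately have "[A + - B = A' + - B'] (mod M)"
        by (metis cong_def)
      \<comment> \<open>Adding the relation to its image under the involution cancels the
        antisymmetric parts.\<close>
      hence "[A + - B + (A + B) = A' + - B' + (A' + B')] (mod M)"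
        unfolding e by (rule cong_add) simp
      hence "[A + A = A' + A'] (mod M)" by simp
      hence "[smult (1/2) (A + A) = smult (1/2) (A' + A')] (mod M)"
        by (rule smult_cong)
      hence "[A = A'] (mod M)" by (simp only: smult_add_right half)
      hence "A = A'" using * by (metis residue_unique)
      thus ?thesis using e by simp
    qed
    thus "(?f x = ?f y) = (x = y)" using xy by auto
  next
    fix x assume "x \<in> sym_res n 1 M \<times> sym_res n (-1) M"
    thus "?f x \<in> {A. A mod M = A}"
      by (auto simp: sym_res_def poly_mod_add_left)
  next
    fix A assume "A \<in> {A. A mod M = A}"
    hence A: "A mod M = A" by simp
    \<comment> \<open>\<open>P\<close> and \<open>N\<close> are the projections of A to the two
      eigenspaces.\<close>
    define P where "P = smult (1/2) (A + recip n A) mod M"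
    define N where "N = smult (1/2) (A - recip n A) mod M"
    have "[recip n P = P] (mod M)"
    proof -
      have "[recip n P = smult (1/2) (recip n A + recip n (recip n A))] (mod M)"
        using rmod[of "smult (1/2) (A + recip n A)"] by (simp add: P_def)
      also have "[smult (1/2) (recip n A + recip n (recip n A)) = smult (1/2) (recip n A + A)] (mod M)"
        by (intro smult_cong cong_add cong_refl rr)
      also have "[smult (1/2) (recip n A + A) = P] (mod M)"
        by (simp add: P_def add.commute)
      finally show ?thesis .
    qed
    moreover have "[recip n N = - N] (mod M)"
    proof -
      have "[recip n N = smult (1/2) (recip n A - recip n (recip n A))] (mod M)"
        using rmod[of "smult (1/2) (A - recip n A)"] by (simp add: N_def)
      also have "[smult (1/2) (recip n A - recip n (recip n A)) = smult (1/2) (recip n A - A)] (mod M)"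
        by (intro smult_cong cong_diff cong_refl rr)
      also have "smult (1/2) (recip n A - A) = - smult (1/2) (A - recip n A)"
        by (simp flip: smult_minus_right)
      also have "[- smult (1/2) (A - recip n A) = - N] (mod M)"
        by (intro cong_uminus) (simp add: N_def)
      finally show ?thesis .
    qed
    ultimately have "(P, N) \<in> sym_res n 1 M \<times> sym_res n (-1) M"
      by (simp add: sym_res_def P_def N_def)
    moreover have "P + N = A"
    proof -
      have "P + N = (smult (1/2) (A + recip n A) + smult (1/2) (A - recip n A)) mod M"
        by (simp add: P_def N_def poly_mod_add_left)
      also have "smult (1/2) (A + recip n A) + smult (1/2) (A - recip n A) = A"
      proof -
        have "(s + t) + (s - t) = s + s" for s t :: "'a poly" by simp
        thus ?thesis by (simp only: smult_add_right smult_diff_right half)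
      qed
      finally show ?thesis using A by simp
    qed
    ultimately show "\<exists>x\<in>sym_res n 1 M \<times> sym_res n (-1) M. A = ?f x"
      by force
  qed
  from bij_betw_same_card[OF this] show ?thesis
    by (simp add: card_cartesian_product card_residues(2)[OF M(1)])
qed

text \<open>Multiplication by \<open>w\<close> maps the residues modulo \<open>M\<close> onto the multiples of
  \<open>W = gcd w (M * W)\<close> among the residues modulo \<open>M * W\<close>.\<close>

lemma card_sym_res_transfer:
  fixes M W w u :: "'a::{field_gcd,finite} poly"
  assumes N: "inv_stable n (M * W)" and M: "inv_stable n M" and n: "n > 0"
    and w: "[recip n w = smult c w] (mod (M * W))" "w = W * u" "coprime u M" and c: "c * c = 1"
  shows "card {A \<in> sym_res n (c * d) (M * W). W dvd A} = card (sym_res n d M)"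
proof -
  define N where "N = M * W"
  have N0: "N \<noteq> 0" "N dvd recip n N" and M0: "M \<noteq> 0" "M dvd recip n M" and W0: "W \<noteq> 0"
    using inv_stable_nz[OF assms(1)] inv_stable_nz[OF assms(2)] assms
    by (auto simp: inv_stable_def N_def)
  \<comment> \<open>Cancelling W lowers the modulus from M * W to M, where the cofactor u is a unit.
    Hence multiplication by w is well defined and injective on residues modulo M.\<close>
  have wN: "[w * A = w * B] (mod N) \<longleftrightarrow> [A = B] (mod M)" for A B
  proof -
    have "w * A - w * B = W * (u * (A - B))" by (simp add: w(2) algebra_simps)
    hence "N dvd w * A - w * B \<longleftrightarrow> M dvd u * (A - B)"
      using W0 by (simp add: N_def mult.commute[of M W])
    also have "\<dots> \<longleftrightarrow> M dvd A - B"
      using w(3) by (simp add: coprime_dvd_mult_right_iff coprime_commute)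
    finally show ?thesis by (simp add: cong_iff_dvd_diff)
  qed
  \<comment> \<open>The involution sends w to c w, so the eigenvalue d becomes c d; a second
    multiplication by c undoes this.\<close>
  have sym: "[recip n (w * B) = smult (c * d) (w * B)] (mod N) \<longleftrightarrow> [recip n B = smult d B] (mod M)" for B
  proof -
    have "[recip n (w * B) = smult c w * recip n B] (mod N)"
      using cong_scalar_right[OF w(1)] by (simp add: N_def)
    hence "[recip n (w * B) = smult (c * d) (w * B)] (mod N)
        \<longleftrightarrow> [smult c w * recip n B = smult (c * d) (w * B)] (mod N)"
      by (simp add: cong_def)
    also have "\<dots> \<longleftrightarrow> [w * recip n B = w * smult d B] (mod N)" (is "?l \<longleftrightarrow> ?r")
    proof
      assume ?l
      from smult_cong[OF this, of c] show ?r by (simp add: c flip: mult.assoc)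
    next
      assume ?r
      from smult_cong[OF this, of c] show ?l by simp
    qed
    finally show ?thesis by (simp only: wN)
  qed
  have reduce: "[recip n (A mod N) = smult e (A mod N)] (mod N) \<longleftrightarrow> [recip n A = smult e A] (mod N)" for A e
  proof -
    have "[recip n (A mod N) = recip n A] (mod N)"
      by (rule recip_cong[OF N0(2)]) simp
    moreover have "[smult e (A mod N) = smult e A] (mod N)"
      by (rule smult_cong) simp
    ultimately show ?thesis by (simp add: cong_def)
  qed
  have "bij_betw (\<lambda>B. (w * B) mod N) (sym_res n d M) {A \<in> sym_res n (c * d) N. W dvd A}"
  proof (rule bij_betwI')
    fix A B assume "A \<in> sym_res n d M" "B \<in> sym_res n d M"
    thus "((w * A) mod N = (w * B) mod N) = (A = B)"
      using wN[of A B] by (auto simp: cong_def sym_res_def)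
  next
    fix B assume "B \<in> sym_res n d M"
    moreover have "W dvd (w * B) mod N"
      by (rule dvd_mod) (simp_all add: w(2) N_def)
    ultimately show "(w * B) mod N \<in> {A \<in> sym_res n (c * d) N. W dvd A}"
      by (simp add: sym_res_def reduce sym del: recip_mult)
  next
    fix A assume "A \<in> {A \<in> sym_res n (c * d) N. W dvd A}"
    hence A: "A mod N = A" "[recip n A = smult (c * d) A] (mod N)" and "W dvd A"
      by (auto simp: sym_res_def)
    then obtain C where C: "A = W * C" by (elim dvdE)
    obtain u' where u': "[u * u' = 1] (mod M)"
    proof -
      obtain a b where "a * u + b * M = 1"
        using w(3) by (metis bezout_coefficients_fst_snd coprime_imp_gcd_eq_1)
      hence "u * a - 1 = M * (- b)" by (simp add: algebra_simps)
      hence "[u * a = 1] (mod M)" by (metis cong_iff_dvd_diff dvd_triv_left)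
      thus ?thesis by (rule that)
    qed
    \<comment> \<open>A preimage of W * C: u' compensates for the cofactor u in w = W * u.\<close>
    define B where "B = (u' * C) mod M"
    have "[w * B = w * (u' * C)] (mod N)"
      by (subst wN) (simp add: B_def)
    also have "w * (u' * C) = W * ((u * u') * C)" by (simp add: w(2) mult_ac)
    also have "[\<dots> = W * (1 * C)] (mod N)"
      using cong_cmult_leftI[OF cong_scalar_right[OF u', of C], of W] by (simp add: N_def mult.commute)
    finally have wB: "[w * B = A] (mod N)" by (simp add: C)
    hence eq: "A = (w * B) mod N" using A(1) by (simp add: cong_def)
    hence "B \<in> sym_res n d M"
      using A(2) by (simp add: sym_res_def reduce sym del: recip_mult) (simp add: B_def)
    thus "\<exists>x\<in>sym_res n d M. A = (w * x) mod N" using eq by blast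
  qed
  from bij_betw_same_card[OF this] show ?thesis by (simp add: N_def)
qed

text \<open>A half-integral power of x turns W into an eigenvector of the involution; that power is
  the unit cofactor in the transfer. Dividing by W thus changes the eigenvalue by the sign of
  W.\<close>

lemma card_sym_res_multiples:
  fixes M W :: "'a::{field_gcd,finite} poly"
  assumes "refl_sign c W" "refl_sign b M" "M * W dvd cyc n" "odd n"
  shows "card {A \<in> sym_res n (c * d) (M * W). W dvd A} = card (sym_res n d M)"
proof -
  define w where "w = monom 1 (degree W * ((n - 1) div 2)) * W"
  have n: "n > 0" using assms(4) by (cases n) auto
  have M: "M dvd cyc n" using assms(3) dvd_mult_left by blast
  show ?thesis
  proof (rule card_sym_res_transfer)
    show "inv_stable n (M * W)"
      using refl_sign_mult[OF assms(2,1)] assms(3) n by (rule inv_stable_refl_sign)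
    show "inv_stable n M" using assms(2) M n by (rule inv_stable_refl_sign)
    show "[recip n w = smult c w] (mod (M * W))"
      unfolding w_def by (rule cong_dvd_modulus[OF refl_sign_half assms(3)]) (use assms in auto)
    show "coprime (monom 1 (degree W * ((n - 1) div 2))) M" by (rule coprime_monom[OF M n])
  qed (use assms n in \<open>auto simp: w_def refl_sign_def\<close>)
qed

text \<open>The transfer with W = 1: multiplication by a unit of sign c. For c = -1 it matches
  symmetric with antisymmetric residues.\<close>

lemma card_sym_res_coprime:
  fixes M f :: "'a::{field_gcd,finite} poly"
  assumes "refl_sign c f" "refl_sign b M" "M dvd cyc n" "odd n" "coprime f M"
  shows "card (sym_res n (c * d) M) = card (sym_res n d M)"
proof -
  define w where "w = monom 1 (degree f * ((n - 1) div 2)) * f"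
  have n: "n > 0" using assms(4) by (cases n) auto
  have M: "inv_stable n M" using assms n by (auto intro: inv_stable_refl_sign)
  have "card {A \<in> sym_res n (c * d) (M * 1). 1 dvd A} = card (sym_res n d M)"
  proof (rule card_sym_res_transfer)
    show "[recip n w = smult c w] (mod (M * 1))"
      unfolding w_def by (rule cong_dvd_modulus[OF refl_sign_half]) (use assms in auto)
    show "coprime w M" using coprime_monom[OF assms(3) n] assms(5) by (simp add: w_def)
  qed (use M assms n in \<open>auto simp: refl_sign_def\<close>)
  thus ?thesis by simp
qed

section \<open>Enumeration by the degree of the gcd\<close>

text \<open>For M = \<open>cyc n\<close> the exponent is n - s, with s the plateau exponent. The
  zero residue contributes 1, its gcd with M being M up to a unit.\<close>

definition sym_gf :: "nat \<Rightarrow> 'a::{field_gcd,finite} poly \<Rightarrow> int poly" where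
  "sym_gf n M = (\<Sum>A\<in>sym_res n 1 M. monom 1 (degree M - degree (gcd A M)))"

lemma degree_normalize_poly: "degree (normalize p) = degree (p :: 'a::field_gcd poly)"
proof (cases "p = 0")
  case False
  thus ?thesis by (intro antisym dvd_imp_degree_le) auto
qed simp

text \<open>A divisor of M1 * M2 splits into divisors of M1 and M2, so the gcd and the product of
  the two gcds divide each other.\<close>

lemma degree_gcd_mult:
  fixes A :: "'a::field_gcd poly"
  assumes "coprime M1 M2" "M1 \<noteq> 0" "M2 \<noteq> 0"
  shows "degree (gcd A (M1 * M2)) = degree (gcd A M1) + degree (gcd A M2)"
proof -
  let ?g = "gcd A M1 * gcd A M2"
  have cop: "coprime (gcd A M1) (gcd A M2)"
    using assms(1) by (meson coprime_divisors gcd_dvd2)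
  have 1: "?g dvd gcd A (M1 * M2)"
    by (intro gcd_greatest divides_mult cop mult_dvd_mono) simp_all
  obtain d1 d2 where d: "gcd A (M1 * M2) = d1 * d2" "d1 dvd M1" "d2 dvd M2"
    using division_decomp[of "gcd A (M1 * M2)" M1 M2] by auto
  have "d1 dvd A" "d2 dvd A"
    by (metis d(1) dvd_mult_left dvd_mult_right gcd_dvd1)+
  hence 2: "gcd A (M1 * M2) dvd ?g"
    unfolding d(1) using d by (intro mult_dvd_mono gcd_greatest)
  have "degree (gcd A (M1 * M2)) = degree ?g"
    using assms by (intro antisym dvd_imp_degree_le 1 2) auto
  thus ?thesis using assms by (simp add: degree_mult_eq)
qed

text \<open>Chinese remainder theorem: as both ideals are stable, the isomorphism respects the
  involution, and additivity of gcd degrees makes the exponents add.\<close>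

lemma sym_gf_mult:
  fixes M1 M2 :: "'a::{field_gcd,finite} poly"
  assumes "coprime M1 M2" "M1 \<noteq> 0" "M2 \<noteq> 0" "M1 dvd recip n M1" "M2 dvd recip n M2"
  shows "sym_gf n (M1 * M2) = sym_gf n M1 * sym_gf n M2"
proof -
  have iff: "[A = B] (mod M1 * M2) \<longleftrightarrow> [A = B] (mod M1) \<and> [A = B] (mod M2)" for A B
  proof -
    have "M1 * M2 dvd A - B \<longleftrightarrow> M1 dvd A - B \<and> M2 dvd A - B"
      by (metis assms(1) divides_mult dvd_mult_left dvd_mult_right)
    thus ?thesis by (simp add: cong_iff_dvd_diff)
  qed
  have red: "[recip n (A mod M) = A] (mod M) \<longleftrightarrow> [recip n A = A] (mod M)"
    if "M dvd recip n M" for A M :: "'a poly"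
  proof -
    have "[recip n (A mod M) = recip n A] (mod M)"
      by (rule recip_cong[OF that]) simp
    thus ?thesis by (simp add: cong_def)
  qed
  have stab: "M1 * M2 dvd recip n (M1 * M2)"
    using assms by (simp add: mult_dvd_mono)
  let ?f = "\<lambda>A. (A mod M1, A mod M2)"
  have bij: "bij_betw ?f (sym_res n 1 (M1 * M2)) (sym_res n 1 M1 \<times> sym_res n 1 M2)"
  proof (rule bij_betwI')
    fix A B assume "A \<in> sym_res n 1 (M1 * M2)" "B \<in> sym_res n 1 (M1 * M2)"
    hence "A mod (M1 * M2) = A" "B mod (M1 * M2) = B" by (auto simp: sym_res_def)
    thus "(?f A = ?f B) = (A = B)"
      using iff[of A B] by (auto simp: cong_def)
  next
    fix A assume "A \<in> sym_res n 1 (M1 * M2)"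
    thus "?f A \<in> sym_res n 1 M1 \<times> sym_res n 1 M2"
      by (simp add: sym_res_def red assms iff)
  next
    fix y assume "y \<in> sym_res n 1 M1 \<times> sym_res n 1 M2"
    then obtain A1 A2 where y: "y = (A1, A2)" "A1 \<in> sym_res n 1 M1" "A2 \<in> sym_res n 1 M2"
      by auto
    obtain a b where ab: "a * M1 + b * M2 = 1"
      using assms(1) by (metis bezout_coefficients_fst_snd coprime_imp_gcd_eq_1)
    \<comment> \<open>The common lift of A1 and A2 built from the Bezout coefficients.\<close>
    define C where "C = A1 * (b * M2) + A2 * (a * M1)"
    have "C - A1 = M1 * (a * (A2 - A1))" "C - A2 = M2 * (b * (A1 - A2))"
    proof -
      have b: "b * M2 = 1 - a * M1" and a: "a * M1 = 1 - b * M2" 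
        using ab by (simp_all add: eq_diff_eq add.commute)
      show "C - A1 = M1 * (a * (A2 - A1))" unfolding C_def b by (simp add: algebra_simps)
      show "C - A2 = M2 * (b * (A1 - A2))" unfolding C_def a by (simp add: algebra_simps)
    qed
    hence "M1 dvd C - A1" "M2 dvd C - A2" by simp_all
    hence C: "C mod M1 = A1" "C mod M2 = A2"
      using y by (simp_all add: sym_res_def cong_def flip: cong_iff_dvd_diff)
    define A where "A = C mod (M1 * M2)"
    have A: "A mod M1 = A1" "A mod M2 = A2"
      unfolding A_def using C by (simp_all add: mod_mod_cancel)
    have "[recip n A = A] (mod M1)" "[recip n A = A] (mod M2)"
      using y red[of M1 A] red[of M2 A] assms cong_mod_right[of "recip n A1" A M1]
        cong_mod_right[of "recip n A2" A M2]
      by (simp_all add: A sym_res_def del: cong_mod_right)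
    hence "A \<in> sym_res n 1 (M1 * M2)"
      by (simp add: sym_res_def iff) (simp add: A_def)
    thus "\<exists>x\<in>sym_res n 1 (M1 * M2). y = ?f x" using A y by auto
  qed
  have le: "degree (gcd A M) \<le> degree M" if "M \<noteq> 0" for A M :: "'a poly"
    using that by (intro dvd_imp_degree_le) auto
  have "sym_gf n M1 * sym_gf n M2 = (\<Sum>(A, B)\<in>sym_res n 1 M1 \<times> sym_res n 1 M2.
      monom 1 (degree M1 - degree (gcd A M1)) * monom 1 (degree M2 - degree (gcd B M2)))"
    by (simp add: sym_gf_def sum_product sum.cartesian_product)
  also have "\<dots> = (\<Sum>A\<in>sym_res n 1 (M1 * M2).
      monom 1 (degree M1 - degree (gcd (A mod M1) M1)) * monom 1 (degree M2 - degree (gcd (A mod M2) M2)))"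
    by (subst sum.reindex_bij_betw[OF bij, symmetric]) simp
  also have "\<dots> = sym_gf n (M1 * M2)"
    unfolding sym_gf_def
  proof (intro sum.cong refl)
    fix A
    show "monom 1 (degree M1 - degree (gcd (A mod M1) M1)) * monom 1 (degree M2 - degree (gcd (A mod M2) M2))
      = (monom 1 (degree (M1 * M2) - degree (gcd A (M1 * M2))) :: int poly)"
      using le[OF assms(2), of A] le[OF assms(3), of A] assms(2,3) degree_gcd_mult[OF assms(1-3), of A]
      by (simp add: mult_monom degree_mult_eq)
  qed
  finally show ?thesis by simp
qed

lemma sym_gf_1: "sym_gf n (1 :: 'a::{field_gcd,finite} poly) = 1"
proof -
  have "sym_res n 1 (1 :: 'a poly) = {0}" by (auto simp: sym_res_def)
  thus ?thesis by (simp add: sym_gf_def)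
qed

text \<open>Stability of the product is carried through the induction because splitting off the next
  factor requires it.\<close>

lemma sym_gf_prod:
  fixes M :: "'b \<Rightarrow> 'a::{field_gcd,finite} poly"
  assumes "finite I" "\<And>i j. i \<in> I \<Longrightarrow> j \<in> I \<Longrightarrow> i \<noteq> j \<Longrightarrow> coprime (M i) (M j)"
    and "\<And>i. i \<in> I \<Longrightarrow> M i \<noteq> 0" "\<And>i. i \<in> I \<Longrightarrow> M i dvd recip n (M i)"
  shows "sym_gf n (\<Prod>i\<in>I. M i) = (\<Prod>i\<in>I. sym_gf n (M i)) \<and> (\<Prod>i\<in>I. M i) dvd recip n (\<Prod>i\<in>I. M i)"
  using assms
proof (induction I rule: finite_induct)
  case empty
  show ?case by (simp add: sym_gf_1)
next
  case (insert i I)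
  have "coprime (M i) (\<Prod>j\<in>I. M j)"
    using insert by (intro prod_coprime_right) auto
  moreover have "sym_gf n (\<Prod>i\<in>I. M i) = (\<Prod>i\<in>I. sym_gf n (M i))
      \<and> (\<Prod>i\<in>I. M i) dvd recip n (\<Prod>i\<in>I. M i)"
    using insert by blast
  ultimately show ?case
    using insert by (simp add: sym_gf_mult mult_dvd_mono)
qed

text \<open>The residues that are invariant under \<open>x \<mapsto> x\<^sup>-\<^sup>1\<close> up to a unit cannot separate the irreducible
  factors of \<open>r\<close>.\<close>

definition sym_prime :: "nat \<Rightarrow> 'a::field_gcd poly \<Rightarrow> bool" where
  "sym_prime n r \<longleftrightarrow> (\<forall>B c k. c \<noteq> 0 \<longrightarrow> r dvd smult c (recip n B) - monom 1 k * B \<longrightarrow>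
     r dvd B \<or> coprime B r)"

text \<open>Write A = r^i B. Cancelling r^i from the symmetry of A leaves B invariant up to a unit
  modulo r, so B is divisible by r, which is excluded, or coprime to r; the gcd is then r^i up to a
  unit.\<close>

lemma sym_prime_degree_gcd:
  fixes r :: "'a::{field_gcd,finite} poly"
  assumes r: "sym_prime n r" "refl_sign c r" "r ^ e dvd cyc n" "n > 0"
    and A: "A \<in> sym_res n 1 (r ^ e)" "r ^ i dvd A" "\<not> r ^ Suc i dvd A" and "i < e"
  shows "degree (gcd A (r ^ e)) = i * degree r"
proof -
  obtain B where B: "A = r ^ i * B" using A by (elim dvdE)
  have r0: "r \<noteq> 0" using r(3,4) \<open>i < e\<close> cyc_nz[of n] by (metis dvd_0_left_iff less_nat_zero_code power_0_left)
  have e: "r ^ e = r ^ i * r ^ (e - i)" using \<open>i < e\<close> by (simp flip: power_add)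
  have "[(monom 1 (degree r) * recip n r) ^ i = (smult c r) ^ i] (mod (r ^ e))"
    using cong_dvd_modulus[OF recip_reflect[OF r(4)] r(3), of r] r(2)
    by (intro cong_pow) (simp add: refl_sign_def)
  hence "[(monom 1 (degree r) * recip n r) ^ i * recip n B = (smult c r) ^ i * recip n B] (mod (r ^ e))"
    by (rule cong_scalar_right)
  moreover have "(monom 1 (degree r) * recip n r) ^ i * recip n B = monom 1 (degree r * i) * recip n A"
    by (simp add: B power_mult_distrib monom_power mult.assoc)
  moreover have "[monom 1 (degree r * i) * recip n A = monom 1 (degree r * i) * A] (mod (r ^ e))"
    using A(1) by (intro cong_scalar_left) (simp add: sym_res_def)
  ultimately have "[(smult c r) ^ i * recip n B = monom 1 (degree r * i) * A] (mod (r ^ e))"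
    by (metis cong_def)
  hence "r ^ e dvd r ^ i * (smult (c ^ i) (recip n B) - monom 1 (degree r * i) * B)"
    by (simp add: cong_iff_dvd_diff B smult_power right_diff_distrib mult_ac)
  hence "r ^ (e - i) dvd smult (c ^ i) (recip n B) - monom 1 (degree r * i) * B"
    unfolding e using r0 by simp
  hence "r dvd smult (c ^ i) (recip n B) - monom 1 (degree r * i) * B"
    by (rule dvd_trans[rotated]) (use \<open>i < e\<close> in \<open>simp add: dvd_power\<close>)
  moreover have "c \<noteq> 0" using r(2) by (auto simp: refl_sign_def)
  ultimately have "r dvd B \<or> coprime B r"
    using r(1) unfolding sym_prime_def by (metis power_not_zero)
  moreover have "\<not> r dvd B" using A(3) r0 by (simp add: B mult.commute[of r])
  ultimately have cop: "coprime B (r ^ (e - i))" by simp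
  have "gcd A (r ^ e) = normalize (r ^ i)"
    unfolding B e using cop by (simp add: gcd_mult_left coprime_imp_gcd_eq_1)
  thus ?thesis by (simp add: degree_power_eq r0 degree_normalize_poly)
qed

text \<open>Symmetric residues are filtered by divisibility by powers of r. Those divisible by
  r^(e-j) but not by r^(e-j+1) have a gcd of degree (e - j) deg r, so that all of them contribute
  the exponent j deg r.\<close>

lemma sym_gf_power:
  fixes r :: "'a::{field_gcd,finite} poly"
  assumes r: "sym_prime n r" "refl_sign c r" "r ^ e dvd cyc n" "n > 0"
  defines "N \<equiv> \<lambda>i. int (card {A \<in> sym_res n 1 (r ^ e). r ^ i dvd A})"
  shows "sym_gf n (r ^ e) = 1 + (\<Sum>j=1..e. monom (N (e - j) - N (e - j + 1)) (j * degree r))"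
proof -
  define T where "T i = {A \<in> sym_res n 1 (r ^ e). r ^ i dvd A}" for i
  have re: "r ^ e \<noteq> 0" using r(3,4) cyc_nz[of n] by (metis dvd_0_left_iff)
  have fin: "finite (T i)" for i
    by (rule finite_subset[OF _ finite_sym_res[OF re]]) (auto simp: T_def)
  have dre: "degree (r ^ e) = e * degree r"
    using re by (cases "r = 0") (auto simp: degree_power_eq power_0_left)
  let ?f = "\<lambda>A. monom (1::int) (degree (r ^ e) - degree (gcd A (r ^ e)))"
  \<comment> \<open>The induction starts at \<open>T e\<close>, which is {0} and gives the constant
    term, and adds one layer at a time.\<close>
  have "(\<Sum>A\<in>T (e - j). ?f A) = 1 + (\<Sum>l=1..j. monom (N (e - l) - N (e - l + 1)) (l * degree r))"
    if "j \<le> e" for j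
    using that
  proof (induction j)
    case 0
    have "T e = {0}" by (auto simp: T_def sym_res_def dvd_eq_mod_eq_0)
    thus ?case by (simp add: degree_normalize_poly)
  next
    case (Suc j)
    have sub: "T (e - j) \<subseteq> T (e - Suc j)"
      by (auto simp: T_def intro: power_le_dvd[where n = "e - j"])
    have Suc_eq: "e - j = Suc (e - Suc j)" using Suc.prems by simp
    have "(\<Sum>A\<in>T (e - Suc j). ?f A) = (\<Sum>A\<in>T (e - Suc j) - T (e - j). ?f A) + (\<Sum>A\<in>T (e - j). ?f A)"
      by (rule sum.subset_diff[OF sub fin])
    also have "(\<Sum>A\<in>T (e - Suc j) - T (e - j). ?f A) =
        (\<Sum>A\<in>T (e - Suc j) - T (e - j). monom 1 (Suc j * degree r))"
    proof (intro sum.cong refl)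
      fix A assume "A \<in> T (e - Suc j) - T (e - j)"
      hence "degree (gcd A (r ^ e)) = (e - Suc j) * degree r"
        unfolding Suc_eq using Suc.prems
        by (intro sym_prime_degree_gcd[OF r]) (auto simp: T_def)
      moreover have "e * degree r - (e - Suc j) * degree r = Suc j * degree r"
        using Suc.prems by (simp only: flip: diff_mult_distrib) simp
      ultimately show "?f A = monom 1 (Suc j * degree r)" by (simp add: dre)
    qed
    also have "\<dots> = monom (int (card (T (e - Suc j) - T (e - j)))) (Suc j * degree r)"
      by (simp add: of_nat_monom mult_monom)
    also have "int (card (T (e - Suc j) - T (e - j))) = N (e - Suc j) - N (e - Suc j + 1)"
    proof -
      have "int (card (T (e - Suc j) - T (e - j))) = int (card (T (e - Suc j))) - int (card (T (e - j)))"
        using sub fin by (simp add: card_Diff_subset of_nat_diff card_mono)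
      thus ?thesis using Suc_eq by (simp add: N_def T_def)
    qed
    also have "(\<Sum>A\<in>T (e - j). ?f A) = 1 + (\<Sum>l=1..j. monom (N (e - l) - N (e - l + 1)) (l * degree r))"
      using Suc by simp
    finally show ?case by (simp add: add_ac)
  qed
  from this[of e] have "(\<Sum>A\<in>T 0. ?f A) = 1 + (\<Sum>j=1..e. monom (N (e - j) - N (e - j + 1)) (j * degree r))"
    by simp
  thus ?thesis by (simp add: T_def sym_gf_def)
qed

section \<open>Factors of \<open>x\<^sup>n - 1\<close>\<close>

lemma poly_cyc: "poly (cyc n) x = x ^ n - 1"
  by (simp add: cyc_def poly_monom)

text \<open>Evaluation at -1, which inversion fixes: an odd degree would give r(-1) = -r(-1), hence
  a root -1 of x^n - 1, but (-1)^n - 1 = -2.\<close>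

lemma even_degree_refl_sign:
  fixes r :: "'a::field_gcd poly"
  assumes "refl_sign 1 r" "r dvd cyc n" "odd n" "(2::'a) \<noteq> 0"
  shows "even (degree r)"
proof (rule ccontr)
  assume odd: "odd (degree r)"
  have "poly r (-1) = poly (reflect_poly r) (-1)"
    using assms(1) by (simp add: refl_sign_def)
  also have "\<dots> = (-1) ^ degree r * poly r (inverse (-1))"
    by (rule poly_reflect_poly_nz) simp
  finally have "2 * poly r (-1) = 0" using odd by simp
  hence "poly r (-1) = 0" using assms(4) by simp
  hence "poly (cyc n) (-1) = (0::'a)" using assms(2) by (auto elim!: dvdE)
  thus False using assms(3,4) by (simp add: poly_cyc)
qed

lemma coprime_linear_poly:
  fixes f :: "'a::field_gcd poly"
  assumes "poly f a \<noteq> 0"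
  shows "coprime [:- a, 1:] f"
proof (rule coprimeI)
  fix d assume d: "d dvd [:- a, 1:]" "d dvd f"
  have "f - [:- a, 1:] * synthetic_div f a = [:poly f a:]"
    using synthetic_div_correct'[of a f] by (metis add_diff_cancel_left')
  hence "d dvd [:poly f a:]" using d by (metis dvd_diff dvd_mult2)
  moreover have "is_unit [:poly f a:]" using assms by (simp add: is_unit_const_poly_iff dvd_field_iff)
  ultimately show "is_unit d" by (rule dvd_unit_imp_unit)
qed

text \<open>x^2 - 1 is x - x^-1 up to the unit x. Its additional root -1 is not a root of x^n - 1
  for odd n, so it is a unit of sign -1 modulo r.\<close>

lemma coprime_square_minus_one:
  fixes r :: "'a::field_gcd poly"
  assumes "r dvd cyc n" "odd n" "(2::'a) \<noteq> 0" "coprime [:-1, 1:] r"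
  shows "coprime [:-1, 0, 1:] r"
proof -
  have "poly r (-1) \<noteq> 0"
  proof
    assume "poly r (-1) = 0"
    hence "poly (cyc n) (-1) = (0::'a)" using assms(1) by (auto elim!: dvdE)
    thus False using assms(2,3) by (simp add: poly_cyc)
  qed
  hence "coprime [:1, 1:] r" using coprime_linear_poly[of r "-1"] by simp
  with assms(4) have "coprime ([:-1, 1:] * [:1, 1:]) r"
    by (simp only: coprime_mult_left_iff)
  thus ?thesis by simp
qed

text \<open>In the split case reflection exchanges the two factors, being involutive on g because
  g(0) is nonzero.\<close>

lemma prime_self_reciprocal_refl_sign:
  assumes "prime_self_reciprocal r"
  shows "refl_sign 1 r"
  using assms unfolding prime_self_reciprocal_def
proof (elim conjE disjE exE)
  assume "self_reciprocal r"
  thus ?thesis by (simp add: self_reciprocal_def refl_sign_def)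
next
  fix u g assume "poly g 0 \<noteq> 0" "r = smult u (g * reflect_poly g)"
  thus ?thesis
    by (simp add: refl_sign_def reflect_poly_mult reflect_poly_smult poly_0_coeff_0 mult.commute)
qed

text \<open>Reflection is multiplicative, and involutive and degree-preserving for nonzero constant
  terms; the factors of the reflection have such terms because their product is the leading
  coefficient of g.\<close>

lemma irreducible_reflect_poly:
  fixes g :: "'a::field_gcd poly"
  assumes "Factorial_Ring.irreducible g" "coeff g 0 \<noteq> 0"
  shows "Factorial_Ring.irreducible (reflect_poly g)"
proof (rule Factorial_Ring.irreducibleI)
  have g0: "g \<noteq> 0" using assms by auto
  thus "reflect_poly g \<noteq> 0" by simp
  have "degree g \<noteq> 0" using assms(1) g0 by (metis Factorial_Ring.irreducible_def is_unit_iff_degree)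
  thus "\<not> is_unit (reflect_poly g)" using assms(2) g0 by (simp add: is_unit_iff_degree)
  fix a b assume ab: "reflect_poly g = a * b"
  have "coeff a 0 * coeff b 0 = lead_coeff g"
    using arg_cong[OF ab, of "\<lambda>p. coeff p 0"] by (simp add: coeff_mult_0)
  hence ab0: "coeff a 0 \<noteq> 0" "coeff b 0 \<noteq> 0" using g0 by auto
  have "g = reflect_poly a * reflect_poly b"
    using arg_cong[OF ab, of reflect_poly] assms(2) by (simp add: reflect_poly_mult)
  hence "is_unit (reflect_poly a) \<or> is_unit (reflect_poly b)"
    using assms(1) by (blast dest: Factorial_Ring.irreducibleD)
  moreover have "is_unit (reflect_poly c) \<Longrightarrow> is_unit c" if "coeff c 0 \<noteq> 0" for c :: "'a poly"
    using that by (cases "c = 0") (auto simp: is_unit_iff_degree)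
  ultimately show "is_unit a \<or> is_unit b" using ab0 by blast
qed

lemma irreducible_dvd_or_coprime:
  fixes g :: "'a::field_gcd poly"
  assumes "Factorial_Ring.irreducible g"
  shows "g dvd B \<or> coprime B g"
  using prime_elem_imp_coprime[of g B] assms
  by (auto simp: coprime_commute field_poly_irreducible_imp_prime)

lemma sym_prime_irreducible:
  "Factorial_Ring.irreducible r \<Longrightarrow> sym_prime n r"
  using irreducible_dvd_or_coprime by (auto simp: sym_prime_def)

text \<open>If h divides B, the reflection of h divides \<open>recip n B\<close>, as it is
  \<open>recip n h\<close> up to a unit modulo itself. The invariance of B modulo r carries this
  divisibility back to B.\<close>

lemma reflect_dvd_of_dvd:
  fixes r h :: "'a::field_gcd poly"
  assumes "reflect_poly h dvd r" "r dvd cyc n" "n > 0" "c \<noteq> 0" "h dvd B"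
    and "r dvd smult c (recip n B) - monom 1 k * B"
  shows "reflect_poly h dvd B"
proof -
  let ?h = "reflect_poly h"
  have cyc: "?h dvd cyc n" using assms dvd_trans by blast
  have cop: "coprime ?h (monom 1 l)" for l
    using coprime_monom[OF cyc assms(3)] by (simp add: coprime_commute)
  have "[monom 1 (degree h) * recip n h = ?h] (mod ?h)"
    by (rule cong_dvd_modulus[OF recip_reflect[OF assms(3)] cyc])
  from cong_dvd_iff[OF this] have "?h dvd monom 1 (degree h) * recip n h" by simp
  hence "?h dvd recip n h" using cop by (simp add: coprime_dvd_mult_right_iff)
  moreover have "recip n h dvd recip n B" using assms(5) by (auto elim!: dvdE)
  ultimately have "?h dvd smult c (recip n B)" by (meson dvd_smult dvd_trans)
  moreover have "?h dvd smult c (recip n B) - monom 1 k * B" using assms(1,6) by (rule dvd_trans)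
  ultimately have "?h dvd monom 1 k * B" using dvd_diff_right_iff by blast
  thus ?thesis using cop by (simp add: coprime_dvd_mult_right_iff)
qed

text \<open>In the split case the invariance of B exchanges divisibility by g and by its reflection.
  So both divide B, and then their product does as they are coprime, or neither does.\<close>

lemma sym_prime_prime_self_reciprocal:
  fixes r :: "'a::field_gcd poly"
  assumes "prime_self_reciprocal r" "r dvd cyc n" "n > 0"
  shows "sym_prime n r"
  using assms(1) unfolding prime_self_reciprocal_def
proof (elim conjE disjE exE)
  assume "Factorial_Ring.irreducible r"
  thus ?thesis by (rule sym_prime_irreducible)
next
  fix u g assume u: "u \<noteq> 0" and g: "lead_coeff g = 1" "Factorial_Ring.irreducible g" "poly g 0 \<noteq> 0"
    "\<not> (\<exists>c. reflect_poly g = smult c g)" and r: "r = smult u (g * reflect_poly g)"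
  let ?h = "reflect_poly g"
  have g0: "coeff g 0 \<noteq> 0" using g by (simp add: poly_0_coeff_0)
  have hh: "reflect_poly ?h = g" using g0 by simp
  have h: "Factorial_Ring.irreducible ?h" by (rule irreducible_reflect_poly) (use g g0 in auto)
  have dvd: "g dvd r" "?h dvd r" using u by (auto simp: r intro: dvd_smult)
  \<comment> \<open>Both have the same degree, so if g divided its reflection the quotient would be
    constant, against the assumption on g.\<close>
  have cop: "coprime g ?h"
  proof (rule ccontr)
    assume "\<not> coprime g ?h"
    hence "g dvd ?h" using irreducible_dvd_or_coprime[OF g(2), of ?h] by (auto simp: coprime_commute)
    then obtain t where t: "?h = g * t" by (elim dvdE)
    have "t \<noteq> 0" using t g0 h by auto
    hence "degree t = 0" using arg_cong[OF t, of degree] g0 g(2) by (auto simp: degree_mult_eq)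
    then obtain c where "t = [:c:]" by (metis degree_eq_zeroE)
    thus False using t g(4) by auto
  qed
  show ?thesis
    unfolding sym_prime_def
  proof (intro allI impI disjCI)
    fix B c k assume c: "c \<noteq> 0" "r dvd smult c (recip n B) - monom 1 k * B" and "\<not> coprime B r"
    have "\<not> (coprime B g \<and> coprime B ?h)"
    proof
      assume "coprime B g \<and> coprime B ?h"
      moreover have "is_unit [:u:]" using u by (simp add: is_unit_const_poly_iff dvd_field_iff)
      ultimately have "coprime B ([:u:] * (g * ?h))"
        by (simp add: is_unit_right_imp_coprime del: mult_pCons_left)
      thus False using \<open>\<not> coprime B r\<close> by (simp add: r)
    qed
    hence "g dvd B \<or> ?h dvd B"
      using irreducible_dvd_or_coprime[OF g(2), of B] irreducible_dvd_or_coprime[OF h, of B] by blast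
    moreover have "g dvd B \<Longrightarrow> ?h dvd B"
      using reflect_dvd_of_dvd[OF dvd(2) assms(2,3) c(1) _ c(2)] .
    moreover have "?h dvd B \<Longrightarrow> g dvd B"
      using reflect_dvd_of_dvd[of ?h, unfolded hh, OF dvd(1) assms(2,3) c(1) _ c(2)] .
    ultimately have "g * ?h dvd B" using cop by (auto intro: divides_mult)
    thus "r dvd B" using u by (simp add: r smult_dvd_iff)
  qed
qed

text \<open>The unit x^2 - 1 of sign -1 matches the two eigenspaces, so each has the square root of
  the total number of residues.\<close>

lemma card_sym_res_even:
  fixes M :: "'a::{field_gcd,finite} poly"
  assumes "refl_sign 1 M" "M dvd cyc n" "odd n" "(2::'a) \<noteq> 0" "coprime [:-1, 0, 1:] M"
  shows "card (sym_res n 1 M) = CARD('a) ^ (degree M div 2)"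
proof -
  have n: "n > 0" using assms(3) by (cases n) auto
  have "refl_sign (-1) [:-1, 0, 1 :: 'a:]"
    by (simp add: refl_sign_def reflect_poly_pCons)
  from card_sym_res_coprime[OF this assms(1,2,3,5), of 1]
  have "card (sym_res n (-1) M) = card (sym_res n 1 M)" by simp
  moreover have "card (sym_res n 1 M) * card (sym_res n (-1) M) = CARD('a) ^ degree M"
    using assms n by (intro card_sym_antisym inv_stable_refl_sign[of 1])
  moreover have "degree M = degree M div 2 + degree M div 2"
    using even_degree_refl_sign[OF assms(1-4)] by auto
  ultimately have "card (sym_res n 1 M) ^ 2 = (CARD('a) ^ (degree M div 2)) ^ 2"
    by (metis power2_eq_square power_add)
  thus ?thesis by simp
qed

text \<open>Multiples of r^(e-j) correspond to symmetric residues modulo r^j, whose number is known;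
  successive differences give the coefficients.\<close>

lemma sym_gf_prime_self_reciprocal:
  fixes r :: "'a::{field_gcd,finite} poly"
  assumes r: "prime_self_reciprocal r" "r ^ e dvd cyc n" "e > 0" "odd n" "(2::'a) \<noteq> 0"
    and cop: "coprime [:-1, 1:] r"
  shows "sym_gf n (r ^ e) = 1 + (\<Sum>j=1..e. monom (int CARD('a) ^ (degree (r ^ j) div 2)
      - int CARD('a) ^ ((degree (r ^ j) - degree r) div 2)) (j * degree r))"
proof -
  have n: "n > 0" using assms(4) by (cases n) auto
  have dvd: "r ^ j dvd cyc n" if "j \<le> e" for j
    using r(2) that by (rule power_le_dvd)
  have r1: "r dvd cyc n" using dvd[of 1] r(3) by simp
  have r0: "r \<noteq> 0" using r1 cyc_nz[OF n] by auto
  have rs: "refl_sign 1 (r ^ j)" for j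
    using refl_sign_power[OF prime_self_reciprocal_refl_sign[OF r(1)], of j] by simp
  have N: "int (card {A \<in> sym_res n 1 (r ^ e). r ^ (e - j) dvd A}) = int CARD('a) ^ (degree (r ^ j) div 2)"
    if "j \<le> e" for j
  proof -
    have e: "r ^ e = r ^ j * r ^ (e - j)" using that by (simp flip: power_add)
    have "card {A \<in> sym_res n (1 * 1) (r ^ j * r ^ (e - j)). r ^ (e - j) dvd A} = card (sym_res n 1 (r ^ j))"
      by (rule card_sym_res_multiples[OF rs rs _ r(4)]) (use r e in simp)
    also have "card (sym_res n 1 (r ^ j)) = CARD('a) ^ (degree (r ^ j) div 2)"
      using coprime_square_minus_one[OF r1 r(4,5) cop] that r
      by (intro card_sym_res_even rs dvd) simp_all
    finally show ?thesis by (simp add: e)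
  qed
  have "sym_gf n (r ^ e) = 1 + (\<Sum>j=1..e. monom (int (card {A \<in> sym_res n 1 (r ^ e). r ^ (e - j) dvd A})
     - int (card {A \<in> sym_res n 1 (r ^ e). r ^ (e - j + 1) dvd A})) (j * degree r))"
    using sym_prime_prime_self_reciprocal[OF r(1) r1 n] prime_self_reciprocal_refl_sign[OF r(1)] r(2) n
    by (rule sym_gf_power)
  also have "\<dots> = 1 + (\<Sum>j=1..e. monom (int CARD('a) ^ (degree (r ^ j) div 2)
      - int CARD('a) ^ ((degree (r ^ j) - degree r) div 2)) (j * degree r))"
  proof (intro arg_cong2[of _ _ _ _ "(+)"] refl sum.cong)
    fix j assume j: "j \<in> {1..e}"
    \<comment> \<open>Rewritten so that the count \<open>N\<close> applies at j - 1; this uses j >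
      0.\<close>
    have "e - j + 1 = e - (j - 1)" using j by auto
    moreover have "degree (r ^ (j - 1)) = degree (r ^ j) - degree r"
      using j by (cases j) (simp_all add: degree_power_eq degree_mult_eq r0)
    ultimately show "monom (int (card {A \<in> sym_res n 1 (r ^ e). r ^ (e - j) dvd A})
        - int (card {A \<in> sym_res n 1 (r ^ e). r ^ (e - j + 1) dvd A})) (j * degree r)
      = monom (int CARD('a) ^ (degree (r ^ j) div 2)
        - int CARD('a) ^ ((degree (r ^ j) - degree r) div 2)) (j * degree r)"
      using N[of j] N[of "j - 1"] j by simp
  qed
  finally show ?thesis .
qed

section \<open>Powers of x - 1\<close>

lemma refl_sign_linear: "refl_sign (-1) [:-1, 1 :: 'a::field_gcd:]"
  by (simp add: refl_sign_def reflect_poly_pCons)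

lemma degree_linear_power: "degree ([:-1, 1 :: 'a::field_gcd:] ^ m) = m"
  by (simp add: degree_power_eq)

text \<open>The involution fixes the point 1, so an antisymmetric A has A(1) = -A(1) = 0. It is thus
  a multiple of x - 1, and division by x - 1 makes it symmetric. For m = 0, truncated subtraction
  leaves the modulus 1 on both sides.\<close>

lemma card_antisym_linear_power:
  assumes "[:-1, 1 :: 'a::{field_gcd,finite}:] ^ m dvd cyc n" "odd n" "(2::'a) \<noteq> 0"
  shows "card (sym_res n (-1) ([:-1, 1 :: 'a:] ^ m)) = card (sym_res n 1 ([:-1, 1 :: 'a:] ^ (m - 1)))"
proof (cases m)
  case 0
  have "sym_res n c (1 :: 'a poly) = {0}" for c by (auto simp: sym_res_def)
  thus ?thesis using 0 by simp
next
  case (Suc k)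
  let ?L = "[:-1, 1 :: 'a:]"
  have M: "?L ^ k * ?L dvd cyc n" using assms(1) by (simp only: Suc power_Suc mult.commute)
  have "?L dvd A" if "A \<in> sym_res n (-1) (?L ^ k * ?L)" for A
  proof -
    have "[recip n A = - A] (mod (?L ^ k * ?L))" using that by (simp add: sym_res_def)
    hence "?L dvd recip n A + A"
      using dvd_mult_right[of "?L ^ k" ?L "recip n A + A"] by (simp add: cong_iff_dvd_diff)
    hence "poly (recip n A + A) 1 = 0" by (simp only: poly_eq_0_iff_dvd)
    hence "2 * poly A 1 = 0" by (simp add: recip_def poly_pcompose poly_monom)
    thus ?thesis using assms(3) by (simp add: poly_eq_0_iff_dvd)
  qed
  hence "sym_res n (-1) (?L ^ k * ?L) = {A \<in> sym_res n (-1 * 1) (?L ^ k * ?L). ?L dvd A}"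
    by auto
  also have "card \<dots> = card (sym_res n 1 (?L ^ k))"
    by (rule card_sym_res_multiples[OF refl_sign_linear refl_sign_power[OF refl_sign_linear] M assms(2)])
  finally show ?thesis by (simp only: Suc power_Suc mult.commute diff_Suc_1)
qed

text \<open>The antisymmetric residues modulo (x - 1)^(m+1) are counted by the induction hypothesis;
  dividing the total number of residues by this count leaves the symmetric ones.\<close>

lemma card_sym_linear_power:
  assumes "[:-1, 1 :: 'a::{field_gcd,finite}:] ^ m dvd cyc n" "odd n" "(2::'a) \<noteq> 0"
  shows "card (sym_res n 1 ([:-1, 1 :: 'a:] ^ m)) = CARD('a) ^ ((m + 1) div 2)"
  using assms(1)
proof (induction m)
  case 0
  have "sym_res n 1 (1 :: 'a poly) = {0}" by (auto simp: sym_res_def)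
  thus ?case by simp
next
  case (Suc m)
  let ?L = "[:-1, 1 :: 'a:]"
  have n: "n > 0" using assms(2) by (cases n) auto
  have "?L ^ m dvd cyc n" using Suc.prems by (rule power_le_dvd) simp
  hence IH: "card (sym_res n 1 (?L ^ m)) = CARD('a) ^ ((m + 1) div 2)" by (rule Suc.IH)
  have "card (sym_res n 1 (?L ^ Suc m)) * card (sym_res n (-1) (?L ^ Suc m)) = CARD('a) ^ degree (?L ^ Suc m)"
    by (rule card_sym_antisym[OF inv_stable_refl_sign[OF refl_sign_power[OF refl_sign_linear] Suc.prems n] n assms(3)])
  also have "card (sym_res n (-1) (?L ^ Suc m)) = CARD('a) ^ ((m + 1) div 2)"
    using card_antisym_linear_power[OF Suc.prems assms(2,3)] IH by simp
  also have "degree (?L ^ Suc m) = (Suc m + 1) div 2 + (m + 1) div 2"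
    unfolding degree_linear_power by presburger
  finally show ?case by (simp add: power_add)
qed

lemma sym_gf_linear_power:
  assumes "[:-1, 1 :: 'a::{field_gcd,finite}:] ^ e dvd cyc n" "odd e" "odd n" "(2::'a) \<noteq> 0"
  shows "sym_gf n ([:-1, 1 :: 'a:] ^ e) =
    1 + (\<Sum>j=1..(e + 1) div 2. monom (int CARD('a) ^ (j - 1) * (int CARD('a) - 1)) (2 * j - 1))"
proof -
  let ?L = "[:-1, 1 :: 'a:]" and ?q = "int CARD('a)"
  have n: "n > 0" using assms(3) by (cases n) auto
  have dvd: "?L ^ j dvd cyc n" if "j \<le> e" for j
    using assms(1) that by (rule power_le_dvd)
  have N: "int (card {A \<in> sym_res n 1 (?L ^ e). ?L ^ (e - j) dvd A}) = ?q ^ ((j + 1) div 2)"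
    if "j \<le> e" for j
  proof -
    have e: "?L ^ e = ?L ^ j * ?L ^ (e - j)" using that by (simp flip: power_add)
    \<comment> \<open>The sign of (x - 1)^(e-j); division by this power yields residues with
      eigenvalue c modulo (x - 1)^j.\<close>
    define c where "c = (-1 :: 'a) ^ (e - j)"
    have "c * c = 1" by (simp add: c_def flip: power_mult_distrib)
    moreover have "card {A \<in> sym_res n (c * c) (?L ^ j * ?L ^ (e - j)). ?L ^ (e - j) dvd A} = card (sym_res n c (?L ^ j))"
      unfolding c_def
      by (rule card_sym_res_multiples[OF refl_sign_power[OF refl_sign_linear] refl_sign_power[OF refl_sign_linear] _ assms(3)])
         (use assms(1) e in simp)
    moreover have "card (sym_res n c (?L ^ j)) = CARD('a) ^ ((j + 1) div 2)"
    proof (cases "even (e - j)")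
      case True
      thus ?thesis using card_sym_linear_power[OF dvd[OF that] assms(3,4)] by (simp add: c_def)
    next
      case False
      \<comment> \<open>Oddness of e excludes antisymmetric residues for odd j, whose number would
        be smaller than claimed.\<close>
      hence "even j" using assms(2) that by simp
      have "card (sym_res n c (?L ^ j)) = card (sym_res n 1 (?L ^ (j - 1)))"
        using card_antisym_linear_power[OF dvd[OF that] assms(3,4)] False by (simp add: c_def)
      also have "\<dots> = CARD('a) ^ ((j - 1 + 1) div 2)"
        using that by (intro card_sym_linear_power dvd assms) simp
      also have "(j - 1 + 1) div 2 = (j + 1) div 2" using \<open>even j\<close> by (cases "j = 0") auto
      finally show ?thesis .
    qed
    ultimately show ?thesis by (simp add: e)
  qed
  have "?L dvd B \<or> coprime B ?L" for B
    using coprime_linear_poly[of B 1] by (auto simp: coprime_commute poly_eq_0_iff_dvd)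
  hence "sym_prime n ?L" by (simp add: sym_prime_def)
  hence "sym_gf n (?L ^ e) = 1 + (\<Sum>j=1..e. monom (int (card {A \<in> sym_res n 1 (?L ^ e). ?L ^ (e - j) dvd A})
     - int (card {A \<in> sym_res n 1 (?L ^ e). ?L ^ (e - j + 1) dvd A})) (j * degree ?L))"
    using refl_sign_linear assms(1) n by (rule sym_gf_power)
  also have "(\<Sum>j=1..e. monom (int (card {A \<in> sym_res n 1 (?L ^ e). ?L ^ (e - j) dvd A})
     - int (card {A \<in> sym_res n 1 (?L ^ e). ?L ^ (e - j + 1) dvd A})) (j * degree ?L))
     = (\<Sum>j=1..e. monom (?q ^ ((j + 1) div 2) - ?q ^ (j div 2)) j)"
  proof (intro sum.cong refl)
    fix j assume j: "j \<in> {1..e}"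
    hence "e - j + 1 = e - (j - 1)" by auto
    thus "monom (int (card {A \<in> sym_res n 1 (?L ^ e). ?L ^ (e - j) dvd A})
        - int (card {A \<in> sym_res n 1 (?L ^ e). ?L ^ (e - j + 1) dvd A})) (j * degree ?L)
      = monom (?q ^ ((j + 1) div 2) - ?q ^ (j div 2)) j"
      using N[of j] N[of "j - 1"] j by simp
  qed
  \<comment> \<open>For even j both exponents are j / 2 and the coefficient vanishes.\<close>
  also have "\<dots> = (\<Sum>j\<in>{j \<in> {1..e}. odd j}. monom (?q ^ ((j + 1) div 2) - ?q ^ (j div 2)) j)"
    by (rule sum.mono_neutral_right) auto
  also have "\<dots> = (\<Sum>j=1..(e + 1) div 2. monom (?q ^ (j - 1) * (?q - 1)) (2 * j - 1))"
  proof (rule sum.reindex_bij_witness[of _ "\<lambda>j. 2 * j - 1" "\<lambda>j. (j + 1) div 2"])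
    fix j assume "j \<in> {j \<in> {1..e}. odd j}"
    then obtain l where l: "j = 2 * l + 1" by (auto elim: oddE)
    show "monom (?q ^ ((j + 1) div 2 - 1) * (?q - 1)) (2 * ((j + 1) div 2) - 1)
        = monom (?q ^ ((j + 1) div 2) - ?q ^ (j div 2)) j"
      by (simp add: l algebra_simps)
  qed (use assms(2) in \<open>auto elim!: oddE\<close>)
  finally show ?thesis .
qed

section \<open>The Frobenius action and the trace\<close>

lemma finite_field_power_card:
  fixes x :: "'k::{field,finite}"
  shows "x ^ CARD('k) = x"
proof (cases "x = 0")
  case False
  have "(\<Prod>y\<in>UNIV - {0}. x * y) = (\<Prod>y\<in>UNIV - {0}. y)"
    by (rule prod.reindex_bij_witness[of _ "\<lambda>y. y / x" "\<lambda>y. x * y"]) (use False in auto)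
  hence "x ^ (CARD('k) - 1) * (\<Prod>y\<in>UNIV - {0::'k}. y) = 1 * (\<Prod>y\<in>UNIV - {0::'k}. y)"
    by (simp add: prod.distrib card_Diff_singleton)
  hence "x ^ (CARD('k) - 1) = 1"
    by (subst (asm) mult_cancel_right) auto
  moreover have "CARD('k) = Suc (CARD('k) - 1)" by (simp add: card_gt_0_iff)
  ultimately show ?thesis by (metis mult.right_neutral power_Suc)
qed (simp add: card_gt_0_iff)

text \<open>Translation by 1 permutes the field, so it leaves the sum of all elements
  unchanged.\<close>

lemma of_nat_card_eq_0: "of_nat CARD('k) = (0 :: 'k::{field,finite})"
proof -
  have "(\<Sum>x\<in>UNIV. x + 1) = (\<Sum>x\<in>UNIV. x :: 'k)"
    by (rule sum.reindex_bij_witness[of _ "\<lambda>x. x - 1" "\<lambda>x. x + 1"]) auto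
  thus ?thesis by (simp add: sum.distrib)
qed

locale finite_ext =
  fixes p n :: nat and tp :: "'p::prime_card itself" and tk :: "'k::{field,finite} itself"
  assumes card_p [simp]: "CARD('p) = p" and card_k: "CARD('k) = p ^ n" and n_pos: "n > 0"
begin

abbreviation emb :: "'p mod_ring \<Rightarrow> 'k" where "emb \<equiv> embed"

lemma prime_p: "prime p"
  using prime_card[where 'a = 'p] by simp

lemma p_pos [simp]: "p > 0"
  using prime_p by (rule prime_gt_0_nat)

lemma CHAR_k: "CHAR('k) = p"
proof -
  have "CHAR('k) dvd p ^ n"
    using of_nat_card_eq_0[where 'k = 'k] by (simp add: card_k of_nat_eq_0_iff_char_dvd flip: of_nat_power)
  moreover have "prime CHAR('k)"
    by (rule prime_CHAR_semidom) (rule finite_imp_CHAR_pos, simp)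
  ultimately show ?thesis
    using prime_p by (metis prime_dvd_power primes_dvd_imp_eq)
qed

lemma prime_CHAR: "prime CHAR('k)"
  by (simp add: CHAR_k prime_p)

lemma emb_0 [simp]: "emb 0 = 0" and emb_1 [simp]: "emb 1 = 1"
  by (simp_all add: embed_def zero_mod_ring.rep_eq one_mod_ring.rep_eq to_int_mod_ring.rep_eq)

lemma of_int_mod_p [simp]: "of_int (x mod int p) = (of_int x :: 'k)"
  using of_int_mod_CHAR[where 'a = 'k, of x] by (simp add: CHAR_k)

lemma emb_add [simp]: "emb (a + b) = emb a + emb b"
  and emb_mult [simp]: "emb (a * b) = emb a * emb b"
  by (simp_all add: embed_def to_int_mod_ring_add to_int_mod_ring_mult)

lemma emb_eq_0 [simp]: "emb c = 0 \<longleftrightarrow> c = 0"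
proof
  assume "emb c = 0"
  hence "CHAR('k) dvd nat (to_int_mod_ring c)"
    using range_to_int_mod_ring[where 'a = 'p]
    by (metis atLeastLessThan_iff embed_def nat_0_le of_int_of_nat_eq of_nat_eq_0_iff_char_dvd rangeI)
  moreover have "0 \<le> to_int_mod_ring c" "to_int_mod_ring c < int p"
    using range_to_int_mod_ring[where 'a = 'p] by (auto simp: set_eq_iff)
  ultimately have "to_int_mod_ring c = 0"
    unfolding CHAR_k by (metis nat_dvd_not_less nat_less_iff not_gr_zero nat_0_iff antisym)
  thus "c = 0" by (metis of_int_mod_ring_to_int_mod_ring of_int_of_int_mod_ring of_int_0)
qed simp

lemma emb_uminus [simp]: "emb (- a) = - emb a"
  using emb_add[of a "- a"] by (simp add: eq_neg_iff_add_eq_0 add.commute)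

lemma emb_diff [simp]: "emb (a - b) = emb a - emb b"
  using emb_add[of a "- b"] by simp

lemma emb_eq [simp]: "emb a = emb b \<longleftrightarrow> a = b"
  using emb_eq_0[of "a - b"] by simp

lemma emb_power_p [simp]: "emb c ^ (p ^ i) = emb c"
proof -
  have pow: "emb c ^ m = emb (c ^ m)" for m by (induction m) simp_all
  have "c ^ (p ^ i) = c" by (rule finite_field_power_card_power_eq_same[of _ i]) simp
  thus ?thesis by (simp add: pow)
qed

lemma frob_add: "(x + y :: 'k) ^ (p ^ i) = x ^ (p ^ i) + y ^ (p ^ i)"
  by (rule freshmans_dream'[OF prime_CHAR]) (simp add: CHAR_k)

lemma frob_sum: "(sum f S :: 'k) ^ (p ^ i) = (\<Sum>x\<in>S. f x ^ (p ^ i))"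
  using prime_p by (induction S rule: infinite_finite_induct) (simp_all add: frob_add prime_gt_0_nat)

lemma power_pn [simp]: "(x :: 'k) ^ (p ^ n) = x"
  using finite_field_power_card[of x] by (simp add: card_k)

lemma power_p_mod: "(x :: 'k) ^ (p ^ (i mod n)) = x ^ (p ^ i)"
proof -
  have "x ^ (p ^ (n * j)) = x" for j
    by (induction j) (simp_all add: power_add power_mult)
  hence "(x ^ (p ^ (n * (i div n)))) ^ (p ^ (i mod n)) = x ^ (p ^ (i mod n))" by simp
  moreover have "(x ^ (p ^ (n * (i div n)))) ^ (p ^ (i mod n)) = x ^ (p ^ i)"
    by (simp flip: power_mult power_add)
  ultimately show ?thesis by simp
qed

text \<open>The action of \<open>F\<^sub>p[x]\<close> on the extension field in which \<open>x\<close> acts as the Frobenius map.\<close>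

definition frob_act :: "'p mod_ring poly \<Rightarrow> 'k \<Rightarrow> 'k" where
  "frob_act A z = (\<Sum>i\<le>degree A. emb (coeff A i) * z ^ (p ^ i))"

lemma frob_act_bound:
  assumes "degree A \<le> m"
  shows "frob_act A z = (\<Sum>i\<le>m. emb (coeff A i) * z ^ (p ^ i))"
  unfolding frob_act_def
  by (rule sum.mono_neutral_left) (use assms in \<open>auto simp: coeff_eq_0\<close>)

lemma frob_act_add [simp]: "frob_act (A + B) z = frob_act A z + frob_act B z"
proof -
  let ?m = "max (degree A) (degree B)"
  have "degree (A + B) \<le> ?m" by (rule degree_add_le) auto
  thus ?thesis
    by (simp add: frob_act_bound[of _ ?m] sum.distrib algebra_simps)
qed

lemma frob_act_smult [simp]: "frob_act (smult c A) z = emb c * frob_act A z"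
  by (simp add: frob_act_bound[OF degree_smult_le] sum_distrib_left mult.assoc frob_act_def[of A])

lemma frob_act_0 [simp]: "frob_act 0 z = 0"
  by (simp add: frob_act_def)

lemma frob_act_uminus [simp]: "frob_act (- A) z = - frob_act A z"
  using frob_act_add[of A "- A" z] by (simp add: eq_neg_iff_add_eq_0 add.commute)

lemma frob_act_diff [simp]: "frob_act (A - B) z = frob_act A z - frob_act B z"
  using frob_act_add[of A "- B"] by simp

lemma frob_act_sum [simp]: "frob_act (sum f S) z = (\<Sum>i\<in>S. frob_act (f i) z)"
  by (induction S rule: infinite_finite_induct) simp_all

lemma frob_act_monom [simp]: "frob_act (monom c i) z = emb c * z ^ (p ^ i)"
proof -
  have "frob_act (monom c i) z = (\<Sum>j\<le>i. emb (coeff (monom c i) j) * z ^ (p ^ j))"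
    by (rule frob_act_bound) (rule degree_monom_le)
  also have "\<dots> = (\<Sum>j\<in>{i}. emb (coeff (monom c i) j) * z ^ (p ^ j))"
    by (rule sum.mono_neutral_right) auto
  finally show ?thesis by simp
qed

lemma frob_act_1 [simp]: "frob_act 1 z = z"
  using frob_act_monom[of 1 0 z] by (simp add: monom_0 one_pCons)

lemma frob_act_pCons: "frob_act (pCons c A) z = emb c * z + frob_act A (z ^ p)"
proof -
  have "frob_act (pCons c A) z = (\<Sum>i\<le>Suc (degree A). emb (coeff (pCons c A) i) * z ^ (p ^ i))"
    by (rule frob_act_bound) (rule degree_pCons_le)
  also have "\<dots> = emb c * z + (\<Sum>i\<le>degree A. emb (coeff A i) * z ^ (p ^ Suc i))"
    by (subst sum.atMost_Suc_shift) simp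
  finally show ?thesis by (simp add: frob_act_def power_mult)
qed

lemma frob_act_arg_add: "frob_act A (y + z) = frob_act A y + frob_act A z"
  by (simp add: frob_act_def frob_add sum.distrib algebra_simps)

lemma frob_act_arg_0 [simp]: "frob_act A 0 = 0"
  by (simp add: frob_act_def zero_power)

lemma frob_act_arg_uminus [simp]: "frob_act A (- z) = - frob_act A z"
  using frob_act_arg_add[of A z "- z"] by (simp add: eq_neg_iff_add_eq_0 add.commute)

lemma frob_act_arg_diff: "frob_act A (y - z) = frob_act A y - frob_act A z"
  using frob_act_arg_add[of A y "- z"] by simp

lemma frob_act_power_p: "frob_act A z ^ p = frob_act A (z ^ p)"
proof -
  have "frob_act A z ^ (p ^ 1) = (\<Sum>i\<le>degree A. emb (coeff A i) * (z ^ (p ^ i)) ^ (p ^ 1))"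
    unfolding frob_act_def frob_sum power_mult_distrib emb_power_p ..
  also have "\<dots> = frob_act A (z ^ p)"
    unfolding frob_act_def by (intro sum.cong refl) (simp add: mult.commute flip: power_mult)
  finally show ?thesis by simp
qed

text \<open>Frobenius is additive and fixes the embedded prime field, hence commutes with every
  \<open>frob_act B\<close>; thus products act as compositions.\<close>

lemma frob_act_mult: "frob_act (A * B) z = frob_act A (frob_act B z)"
proof (induction A arbitrary: z)
  case (pCons c A)
  thus ?case by (simp add: frob_act_pCons frob_act_power_p)
qed simp

text \<open>The n-th power of Frobenius is the identity, so the field is a module over F_p[x]/(x^n -
  1).\<close>

lemma frob_act_cyc [simp]: "frob_act (cyc n) z = 0"
  by (simp add: cyc_def)

definition frob_ker :: "'p mod_ring poly \<Rightarrow> 'k set" where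
  "frob_ker A = {z. frob_act A z = 0}"

text \<open>The kernel is the root set of the linearised polynomial associated with D, which has
  degree at most p^(deg D).\<close>

lemma card_frob_ker_le:
  assumes "D \<noteq> 0"
  shows "card (frob_ker D) \<le> p ^ degree D"
proof -
  define P where "P = (\<Sum>i\<le>degree D. monom (emb (coeff D i)) (p ^ i))"
  have "poly P z = frob_act D z" for z
    by (simp add: P_def frob_act_def poly_sum poly_monom)
  hence ker: "frob_ker D = {z. poly P z = 0}" by (simp add: frob_ker_def)
  have p1: "p > 1" using prime_p by (rule prime_gt_1_nat)
  \<comment> \<open>The exponents p^i are distinct, so only the leading coefficient of D contributes
    here.\<close>
  have "coeff P (p ^ degree D) = (\<Sum>i\<le>degree D. if i = degree D then emb (coeff D i) else 0)"
    unfolding P_def coeff_sum using p1 by (intro sum.cong) auto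
  also have "\<dots> \<noteq> 0" using assms by simp
  finally have "P \<noteq> 0" by auto
  moreover have "degree P \<le> p ^ degree D"
    unfolding P_def
  proof (rule degree_sum_le)
    fix i assume "i \<in> {..degree D}"
    hence "p ^ i \<le> p ^ degree D" using p1 by (intro power_increasing) auto
    thus "degree (monom (emb (coeff D i)) (p ^ i)) \<le> p ^ degree D"
      using degree_monom_le order_trans by blast
  qed simp
  ultimately show ?thesis
    unfolding ker using card_poly_roots_bound[of P] by simp
qed

text \<open>With x^n - 1 = D E, the image of E lies in the kernel of D, and its fibres have the size
  of the kernel of E, at most p^(deg E). Hence p^n is at most |ker D| p^(deg E), which forces
  equality in the root bound for D.\<close>

lemma card_frob_ker_dvd_cyc:
  assumes "D dvd cyc n"
  shows "card (frob_ker D) = p ^ degree D"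
proof (rule antisym)
  obtain E where E: "cyc n = D * E" using assms by (elim dvdE)
  have nz: "D \<noteq> 0" "E \<noteq> 0" using E cyc_nz[OF n_pos, where 'a = "'p mod_ring"] by auto
  show "card (frob_ker D) \<le> p ^ degree D" by (rule card_frob_ker_le[OF nz(1)])
  have range: "range (frob_act E) \<subseteq> frob_ker D"
    by (auto simp: frob_ker_def simp flip: frob_act_mult E)
  have fib: "card {x. frob_act E x = y} = card (frob_ker E)" if y: "y \<in> range (frob_act E)" for y
  proof -
    obtain x0 where x0: "y = frob_act E x0" using y by blast
    have "bij_betw (\<lambda>x. x + x0) (frob_ker E) {x. frob_act E x = y}"
      by (rule bij_betwI[where g = "\<lambda>x. x - x0"]) (auto simp: frob_ker_def x0 frob_act_arg_add frob_act_arg_diff)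
    from bij_betw_same_card[OF this] show ?thesis by simp
  qed
  have "UNIV = (\<Union>y\<in>range (frob_act E). {x. frob_act E x = y})" by auto
  hence "CARD('k) \<le> (\<Sum>y\<in>range (frob_act E). card {x. frob_act E x = y})"
    using card_UN_le[of "range (frob_act E)" "\<lambda>y. {x. frob_act E x = y}"] by (simp only: finite)
  also have "\<dots> = card (range (frob_act E)) * card (frob_ker E)"
    using fib by simp
  also have "\<dots> \<le> card (frob_ker D) * p ^ degree E"
    by (intro mult_mono card_mono range card_frob_ker_le nz) auto
  finally have "CARD('k) \<le> card (frob_ker D) * p ^ degree E" .
  moreover have "degree D + degree E = n"
    using arg_cong[OF E, of degree] nz degree_cyc[OF n_pos, where 'a = "'p mod_ring"]
    by (simp add: degree_mult_eq)
  hence "CARD('k) = p ^ degree D * p ^ degree E" by (simp add: card_k flip: power_add)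
  ultimately show "p ^ degree D \<le> card (frob_ker D)" by simp
qed

text \<open>By Bezout, A and its gcd with x^n - 1 have the same kernel, as x^n - 1 acts as
  zero.\<close>

lemma card_frob_ker: "card (frob_ker A) = p ^ degree (gcd A (cyc n))"
proof -
  let ?D = "gcd A (cyc n)"
  have "frob_ker A = frob_ker ?D"
  proof (intro equalityI subsetI)
    fix z assume z: "z \<in> frob_ker ?D"
    obtain B where "A = B * ?D" by (metis dvd_div_mult_self gcd_dvd1)
    hence "frob_act A z = frob_act B (frob_act ?D z)" by (metis frob_act_mult)
    thus "z \<in> frob_ker A" using z by (simp add: frob_ker_def)
  next
    fix z assume z: "z \<in> frob_ker A"
    obtain a b where "a * A + b * cyc n = ?D" by (metis bezout_coefficients_fst_snd)
    hence "frob_act ?D z = frob_act a (frob_act A z) + frob_act b (frob_act (cyc n) z)"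
      by (metis frob_act_add frob_act_mult)
    thus "z \<in> frob_ker ?D" using z by (simp add: frob_ker_def)
  qed
  thus ?thesis by (simp add: card_frob_ker_dvd_cyc)
qed

text \<open>The p embedded elements exhaust the roots of x^p - x, of which there are at most
  p.\<close>

lemma range_emb: "range emb = {x. x ^ p = x}"
proof (rule card_subset_eq)
  show "range emb \<subseteq> {x. x ^ p = x}" using emb_power_p[of _ 1] by auto
  have p1: "p > 1" using prime_p by (rule prime_gt_1_nat)
  let ?P = "monom 1 p - monom 1 1 :: 'k poly"
  have "coeff ?P p = 1" using p1 by simp
  hence "?P \<noteq> 0" by (metis coeff_0 zero_neq_one)
  moreover have "degree ?P \<le> p"
    using p1 by (intro degree_diff_le) (auto simp: degree_monom_eq)
  moreover have "{x. poly ?P x = 0} = {x. x ^ p = x}" by (simp add: poly_monom)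
  ultimately have "card {x::'k. x ^ p = x} \<le> p"
    using card_poly_roots_bound[of ?P] by simp
  moreover have "card (range emb) = p"
    by (subst card_image) (auto intro: injI)
  moreover have "card (range emb) \<le> card {x::'k. x ^ p = x}"
    by (intro card_mono) (use emb_power_p[of _ 1] in auto)
  ultimately show "card (range emb) = card {x::'k. x ^ p = x}"
    by simp
qed simp

section \<open>The absolute trace\<close>

abbreviation tr :: "'k \<Rightarrow> 'p mod_ring" where "tr \<equiv> abs_trace n"

lemma sum_conj_shift: "(\<Sum>i<n. (x :: 'k) ^ (p ^ Suc i)) = (\<Sum>i<n. x ^ (p ^ i))"
proof -
  have "(\<Sum>i<Suc n. x ^ (p ^ i)) = x + (\<Sum>i<n. x ^ (p ^ Suc i))"
    by (subst sum.lessThan_Suc_shift) simp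
  thus ?thesis by simp
qed

text \<open>Frobenius permutes the conjugates cyclically, so their sum lies in the prime field and
  the description in \<open>abs_trace\<close> has a unique solution.\<close>

lemma emb_tr: "emb (tr x) = (\<Sum>i<n. x ^ (p ^ i))"
proof -
  have "(\<Sum>i<n. x ^ (p ^ i)) ^ (p ^ 1) = (\<Sum>i<n. x ^ (p ^ Suc i))"
    unfolding frob_sum by (intro sum.cong refl) (simp add: mult.commute flip: power_mult)
  hence "(\<Sum>i<n. x ^ (p ^ i)) \<in> {x. x ^ p = x}"
    using sum_conj_shift[of x] by simp
  then obtain c where c: "(\<Sum>i<n. x ^ (p ^ i)) = emb c"
    unfolding range_emb[symmetric] by auto
  have "tr x = (THE c'. emb c' = emb c)" by (simp only: abs_trace_def card_p c)
  also have "\<dots> = c" by simp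
  finally have "tr x = c" .
  thus ?thesis by (simp add: c)
qed

lemma tr_add [simp]: "tr (x + y) = tr x + tr y"
  using emb_eq[of "tr (x + y)" "tr x + tr y"] by (simp add: emb_tr frob_add sum.distrib del: emb_eq)

lemma tr_0 [simp]: "tr 0 = 0"
  using emb_tr[of 0] by (simp add: zero_power)

lemma tr_uminus [simp]: "tr (- x) = - tr x"
  using tr_add[of x "- x"] by (simp add: eq_neg_iff_add_eq_0 add.commute)

lemma tr_diff [simp]: "tr (x - y) = tr x - tr y"
  using tr_add[of x "- y"] by simp

lemma tr_sum [simp]: "tr (sum f S) = (\<Sum>i\<in>S. tr (f i))"
  by (induction S rule: infinite_finite_induct) simp_all

lemma tr_emb_mult [simp]: "tr (emb c * x) = c * tr x"
  using emb_eq[of "tr (emb c * x)" "c * tr x"]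
  by (simp add: emb_tr power_mult_distrib sum_distrib_left del: emb_eq)

lemma tr_power_p: "tr (x ^ p) = tr x"
proof -
  have "emb (tr (x ^ p)) = (\<Sum>i<n. x ^ (p ^ Suc i))"
    by (simp add: emb_tr power_mult)
  also have "\<dots> = emb (tr x)"
    unfolding sum_conj_shift emb_tr ..
  finally show ?thesis by simp
qed

lemma tr_power: "tr (x ^ (p ^ i)) = tr x"
proof (induction i)
  case (Suc i)
  have "x ^ (p ^ Suc i) = (x ^ (p ^ i)) ^ p" by (simp add: mult.commute flip: power_mult)
  thus ?case using Suc tr_power_p by simp
qed simp

text \<open>The trace is the action of 1 + x + ... + x^(n-1), whose degree is below n, so its kernel
  has fewer than p^n elements.\<close>

lemma tr_nontrivial: "\<exists>x. tr x \<noteq> 0"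
proof (rule ccontr)
  assume "\<not> ?thesis"
  hence tr: "tr x = 0" for x by simp
  define A where "A = (\<Sum>i<n. monom (1 :: 'p mod_ring) i)"
  have "frob_act A x = emb (tr x)" for x by (simp add: A_def emb_tr)
  hence ker: "frob_ker A = UNIV" using tr by (simp add: frob_ker_def)
  have co: "coeff A i = (if i < n then 1 else 0)" for i by (simp add: A_def coeff_sum)
  have "degree A < n" using n_pos co by (intro degree_lessI) auto
  moreover have "A \<noteq> 0" using co[of 0] n_pos by auto
  hence "p ^ n \<le> p ^ degree A"
    using card_frob_ker_le[of A] ker by (simp add: card_k)
  hence "n \<le> degree A" using prime_gt_1_nat[OF prime_p] by simp
  ultimately show False by simp
qed

end

section \<open>Additive characters and the Walsh transform\<close>

definition add_char :: "'p::prime_card mod_ring \<Rightarrow> complex" where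
  "add_char c = exp (2 * of_real pi * \<i> / of_nat CARD('p)) powi to_int_mod_ring c"

lemma to_int_mod_ring_bounds:
  "0 \<le> to_int_mod_ring (c :: 'p::prime_card mod_ring)" "to_int_mod_ring c < int CARD('p)"
  using range_to_int_mod_ring[where 'a = 'p] by (auto simp: set_eq_iff)

lemma add_char_cis:
  "add_char (c :: 'p::prime_card mod_ring) = cis (2 * pi * real (nat (to_int_mod_ring c)) / real CARD('p))"
proof -
  have "exp (2 * of_real pi * \<i> / of_nat CARD('p)) = cis (2 * pi / real CARD('p))"
    unfolding cis_conv_exp by (rule arg_cong[of _ _ exp]) (simp add: field_simps)
  moreover have "z powi to_int_mod_ring c = z ^ nat (to_int_mod_ring c)" for z :: complex
    using to_int_mod_ring_bounds[of c] by (simp add: power_int_def)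
  ultimately show ?thesis
    by (simp add: add_char_def Complex.DeMoivre mult_ac)
qed

lemma add_char_0 [simp]: "add_char 0 = 1"
  by (simp add: add_char_def zero_mod_ring.rep_eq to_int_mod_ring.rep_eq)

text \<open>Integer representatives add only modulo p, which is harmless because the base is a p-th
  root of unity.\<close>

lemma add_char_add: "add_char (a + b) = add_char a * add_char (b :: 'p::prime_card mod_ring)"
proof -
  let ?z = "exp (2 * of_real pi * \<i> / of_nat CARD('p)) :: complex"
  have "?z ^ CARD('p) = exp (of_nat CARD('p) * (2 * of_real pi * \<i> / of_nat CARD('p)))"
    by (rule exp_of_nat_mult[symmetric])
  also have "\<dots> = 1" by simp
  finally have z: "?z powi int CARD('p) = 1" by simp
  have mod: "?z powi (x mod int CARD('p)) = ?z powi x" for x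
  proof -
    have "?z powi (int CARD('p) * (x div int CARD('p)) + x mod int CARD('p))
        = (?z powi int CARD('p)) powi (x div int CARD('p)) * ?z powi (x mod int CARD('p))"
      by (simp only: power_int_add power_int_mult exp_not_eq_zero simp_thms)
    thus ?thesis unfolding z by simp
  qed
  show ?thesis
    by (simp add: add_char_def to_int_mod_ring_add mod power_int_add)
qed

lemma cmod_add_char [simp]: "cmod (add_char c) = 1"
  by (simp add: add_char_cis)

lemma add_char_uminus: "add_char (- c) = cnj (add_char c)"
proof -
  have "add_char c * add_char (- c) = add_char c * cnj (add_char c)"
    by (simp flip: add_char_add add: complex_norm_square[symmetric])
  thus ?thesis by (metis cmod_add_char mult_cancel_left norm_zero zero_neq_one)
qed

lemma add_char_neq_1:
  assumes "c \<noteq> 0"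
  shows "add_char (c :: 'p::prime_card mod_ring) \<noteq> 1"
proof
  let ?p = "CARD('p)"
  assume 1: "add_char c = 1"
  have p: "?p > 0" by simp
  have "nat (to_int_mod_ring c) = 0"
  proof (rule inj_onD[OF bij_betw_imp_inj_on[OF bij_betw_roots_unity[OF p]]])
    show "cis (2 * pi * real (nat (to_int_mod_ring c)) / real ?p) = cis (2 * pi * real 0 / real ?p)"
      using 1 by (simp add: add_char_cis)
  qed (use to_int_mod_ring_bounds[of c] in auto)
  hence "to_int_mod_ring c = 0" using to_int_mod_ring_bounds[of c] by simp
  hence "c = 0" by (metis of_int_mod_ring_to_int_mod_ring of_int_of_int_mod_ring of_int_0)
  thus False using assms by simp
qed

text \<open>Orthogonality: translation by k in K with g k nonzero multiplies the sum by a number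
  other than 1, so the sum is 0.\<close>

lemma sum_add_char:
  fixes g :: "'k::{field,finite} \<Rightarrow> 'p::prime_card mod_ring"
  assumes K: "\<And>x y. x \<in> K \<Longrightarrow> y \<in> K \<Longrightarrow> x + y \<in> K" "\<And>x y. x \<in> K \<Longrightarrow> y \<in> K \<Longrightarrow> x - y \<in> K"
    and g: "\<And>x y. x \<in> K \<Longrightarrow> y \<in> K \<Longrightarrow> g (x + y) = g x + g y"
  shows "(\<Sum>x\<in>K. add_char (g x)) = (if \<forall>x\<in>K. g x = 0 then of_nat (card K) else 0)"
proof (cases "\<forall>x\<in>K. g x = 0")
  case False
  then obtain k where k: "k \<in> K" "g k \<noteq> 0" by auto
  have "(\<Sum>x\<in>K. add_char (g x)) = (\<Sum>x\<in>K. add_char (g (k + x)))"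
    by (rule sum.reindex_bij_witness[of _ "\<lambda>x. k + x" "\<lambda>x. x - k"]) (use K k in auto)
  also have "\<dots> = add_char (g k) * (\<Sum>x\<in>K. add_char (g x))"
    using k by (simp add: g add_char_add sum_distrib_left)
  finally have "(1 - add_char (g k)) * (\<Sum>x\<in>K. add_char (g x)) = 0"
    by (simp add: algebra_simps)
  hence "(\<Sum>x\<in>K. add_char (g x)) = 0" using add_char_neq_1[OF k(2)] by simp
  thus ?thesis by (simp only: if_not_P[OF False])
qed simp

lemma walsh_add_char: "walsh n f b = (\<Sum>x\<in>UNIV. add_char (f x - abs_trace n (b * x)))"
  by (simp add: walsh_def add_char_def)

text \<open>The element \<open>\<Sum> a\<^sub>i (x\<^sup>i + x\<^sup>-\<^sup>i)\<close> of \<open>F[x]/(x\<^sup>n - 1)\<close>, which describes the polarisation of the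
  quadratic form.\<close>

definition quad_poly :: "nat \<Rightarrow> (nat \<Rightarrow> 'a::field_gcd) \<Rightarrow> 'a poly" where
  "quad_poly n a = (\<Sum>i=0..n div 2. monom (a i) i + monom (a i) ((n - i) mod n))"

text \<open>For odd n and 0 < i <= n div 2 the exponent n - i lies strictly above n div 2, so the
  lower half shows the a_i directly. For i = 0 both exponents are 0, whence the factor 2.\<close>

lemma coeff_quad_poly:
  assumes "odd n" "j \<le> n div 2"
  shows "coeff (quad_poly n a) j = (if j = 0 then 2 * a 0 else a j)"
proof -
  have eq: "(n - i) mod n = j \<longleftrightarrow> i = 0 \<and> j = 0" if "i \<le> n div 2" for i
  proof (cases "i = 0")
    case False
    hence "(n - i) mod n = n - i" using that assms by (intro mod_less) (auto elim!: oddE)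
    moreover have "n div 2 < n - i" using that assms by (auto elim!: oddE)
    ultimately show ?thesis using False assms by auto
  qed auto
  have "coeff (quad_poly n a) j = (\<Sum>i=0..n div 2. (if i = j then a i else 0)) +
      (\<Sum>i=0..n div 2. (if (n - i) mod n = j then a i else 0))"
    by (simp add: quad_poly_def coeff_sum sum.distrib)
  also have "(\<Sum>i=0..n div 2. (if (n - i) mod n = j then a i else 0))
      = (\<Sum>i=0..n div 2. if i = 0 then (if j = 0 then a 0 else 0) else 0)"
    by (intro sum.cong refl) (auto simp: eq)
  finally show ?thesis using assms(2) by (simp add: sum.delta)
qed

lemma residue_cyc:
  "n > 0 \<Longrightarrow> A mod cyc n = A \<longleftrightarrow> (\<forall>j\<ge>n. coeff (A :: 'a::field_gcd poly) j = 0)"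
  by (simp add: residue_iff cyc_nz degree_cyc)

lemma cong_neg_exponent:
  fixes n i :: nat
  assumes "n > 0" "i \<le> n"
  shows "[(n - 1) * i = (n - i) mod n] (mod n)"
proof -
  obtain m where "n = Suc m" using assms(1) gr0_implies_Suc by blast
  hence "(n - 1) * i + i = n * i" by simp
  hence "[(n - 1) * i + i = (n - i) + i] (mod n)" using assms(2) by (simp add: cong_def)
  thus ?thesis by (simp add: cong_add_rcancel_nat)
qed

text \<open>Modulo x^n - 1 the involution permutes coefficients by j -> -j modulo n. The permuted
  polynomial \<open>R\<close> is already reduced, so the congruence is an equality.\<close>

lemma sym_res_cyc_coeff:
  fixes A :: "'a::field_gcd poly"
  assumes "A \<in> sym_res n 1 (cyc n)" "0 < j" "j < n"
  shows "coeff A (n - j) = coeff A j"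
proof -
  have n: "n > 0" using assms by simp
  have A: "\<forall>j\<ge>n. coeff A j = 0" "[recip n A = A] (mod cyc n)" "A mod cyc n = A"
    using assms(1) residue_cyc[OF n, of A] by (auto simp: sym_res_def)
  define R where "R = (\<Sum>i<n. monom (coeff A i) ((n - i) mod n))"
  have sum: "A = (\<Sum>i<n. monom (coeff A i) i)"
    by (intro poly_eqI) (use A(1) in \<open>auto simp: coeff_sum\<close>)
  have "recip n A = (\<Sum>i<n. monom (coeff A i) ((n - 1) * i))"
    by (subst sum) simp
  also have "[\<dots> = R] (mod cyc n)"
    unfolding R_def by (intro cong_sum cong_monom cong_neg_exponent n) auto
  finally have "[A = R] (mod cyc n)" using A(2) by (metis cong_sym cong_trans)
  moreover have "R mod cyc n = R"
    unfolding residue_cyc[OF n]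
  proof (intro allI impI)
    fix j assume "j \<ge> n"
    moreover have "(n - i) mod n < n" for i using n by simp
    ultimately have "(n - i) mod n \<noteq> j" for i by (metis linorder_not_less)
    thus "coeff R j = 0" by (simp add: R_def coeff_sum)
  qed
  ultimately have "A = R" using A(3) by (metis residue_unique)
  moreover have "coeff R j = (\<Sum>i\<in>{n - j}. coeff A i)"
  proof -
    have "coeff R j = (\<Sum>i<n. if (n - i) mod n = j then coeff A i else 0)"
      by (simp add: R_def coeff_sum)
    also have "\<dots> = (\<Sum>i\<in>{n - j}. if (n - i) mod n = j then coeff A i else 0)"
    proof (rule sum.mono_neutral_right)
      show "\<forall>i\<in>{..<n} - {n - j}. (if (n - i) mod n = j then coeff A i else 0) = 0"
      proof
        fix i assume i: "i \<in> {..<n} - {n - j}"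
        have "(n - i) mod n \<noteq> j" using i assms by (cases "i = 0") auto
        thus "(if (n - i) mod n = j then coeff A i else 0) = 0" by simp
      qed
    qed (use assms in auto)
    finally show ?thesis using assms by simp
  qed
  ultimately show ?thesis by simp
qed

lemma quad_poly_sym:
  fixes a :: "nat \<Rightarrow> 'a::field_gcd"
  assumes n: "n > 0"
  shows "quad_poly n a \<in> sym_res n 1 (cyc n)"
proof -
  have "\<forall>j\<ge>n. coeff (quad_poly n a) j = 0"
  proof (intro allI impI)
    fix j assume j: "j \<ge> n"
    have "(n - i) mod n < n" for i using n by simp
    hence "(n - i) mod n \<noteq> j" for i using j by (metis linorder_not_less)
    moreover have "i \<noteq> j" if "i \<le> n div 2" for i using that j n by (auto simp: div_le_dividend)
    ultimately show "coeff (quad_poly n a) j = 0"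
      by (auto simp: quad_poly_def coeff_sum intro!: sum.neutral)
  qed
  moreover have "[recip n (quad_poly n a) = quad_poly n a] (mod cyc n)"
  proof -
    have "recip n (quad_poly n a)
        = (\<Sum>i=0..n div 2. monom (a i) ((n - 1) * i) + monom (a i) ((n - 1) * ((n - i) mod n)))"
      by (simp add: quad_poly_def)
    also have "[\<dots> = (\<Sum>i=0..n div 2. monom (a i) ((n - i) mod n) + monom (a i) i)] (mod cyc n)"
    proof (intro cong_sum cong_add cong_monom)
      fix i assume "i \<in> {0..n div 2}"
      hence i: "i \<le> n" using div_le_dividend[of n 2] by simp
      show "[(n - 1) * i = (n - i) mod n] (mod n)" by (rule cong_neg_exponent[OF n i])
      have "[(n - 1) * ((n - i) mod n) = (n - 1) * (n - i)] (mod n)"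
        by (intro cong_scalar_left) simp
      also have "[(n - 1) * (n - i) = (n - (n - i)) mod n] (mod n)"
        by (rule cong_neg_exponent[OF n]) simp
      finally show "[(n - 1) * ((n - i) mod n) = i] (mod n)" using i by simp
    qed
    also have "(\<Sum>i=0..n div 2. monom (a i) ((n - i) mod n) + monom (a i) i) = quad_poly n a"
      unfolding quad_poly_def by (intro sum.cong refl add.commute)
    finally show ?thesis .
  qed
  ultimately show ?thesis by (simp add: sym_res_def residue_cyc[OF n])
qed

text \<open>The lower half of the coefficients recovers the tuple, as 2 is invertible, and symmetry
  determines the upper half; n being odd, no exponent is paired with itself except 0.\<close>

lemma bij_betw_quad_poly:
  fixes n :: nat
  assumes "odd n" "(2 :: 'a::field_gcd) \<noteq> 0"
  shows "bij_betw (quad_poly n) ({0..n div 2} \<rightarrow>\<^sub>E (UNIV :: 'a set)) (sym_res n 1 (cyc n))"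
proof (rule bij_betwI')
  have n: "n > 0" using assms by (cases n) auto
  fix a :: "nat \<Rightarrow> 'a" assume a: "a \<in> {0..n div 2} \<rightarrow>\<^sub>E UNIV"
  show "quad_poly n a \<in> sym_res n 1 (cyc n)" by (rule quad_poly_sym[OF n])
  fix b :: "nat \<Rightarrow> 'a" assume b: "b \<in> {0..n div 2} \<rightarrow>\<^sub>E UNIV"
  show "(quad_poly n a = quad_poly n b) = (a = b)"
  proof
    assume eq: "quad_poly n a = quad_poly n b"
    show "a = b"
    proof
      fix i show "a i = b i"
      proof (cases "i \<le> n div 2")
        case True
        thus ?thesis
          using coeff_quad_poly[OF assms(1) True, of a] coeff_quad_poly[OF assms(1) True, of b] eq assms(2)
          by (cases "i = 0") auto
      next
        case False
        thus ?thesis using PiE_arb[OF a, of i] PiE_arb[OF b, of i] by simp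
      qed
    qed
  qed simp
next
  have n: "n > 0" using assms by (cases n) auto
  fix A :: "'a poly" assume A: "A \<in> sym_res n 1 (cyc n)"
  \<comment> \<open>The constant term is halved because a_0 enters it twice.\<close>
  define a where "a = restrict (\<lambda>i. if i = 0 then coeff A 0 / 2 else coeff A i) {0..n div 2}"
  have a: "a \<in> {0..n div 2} \<rightarrow>\<^sub>E UNIV" by (auto simp: a_def)
  have q: "quad_poly n a \<in> sym_res n 1 (cyc n)" by (rule quad_poly_sym[OF n])
  have low: "coeff (quad_poly n a) j = coeff A j" if "j \<le> n div 2" for j
    using coeff_quad_poly[OF assms(1) that, of a] that assms(2) by (auto simp: a_def)
  have "A = quad_poly n a"
  proof (intro poly_eqI)
    fix j
    consider "j \<le> n div 2" | "n div 2 < j" "j < n" | "j \<ge> n" by linarith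
    thus "coeff A j = coeff (quad_poly n a) j"
    proof cases
      case 2
      have "n - j \<le> n div 2" using 2 assms(1) by (auto elim!: oddE)
      thus ?thesis
        using low[of "n - j"] sym_res_cyc_coeff[OF A, of j] sym_res_cyc_coeff[OF q, of j] 2 by simp
    next
      case 3
      thus ?thesis using A q by (simp add: sym_res_def residue_cyc[OF n])
    qed (simp add: low)
  qed
  thus "\<exists>a\<in>{0..n div 2} \<rightarrow>\<^sub>E UNIV. A = quad_poly n a" using a by blast
qed

lemma two_neq_0_mod_ring:
  assumes "odd CARD('p)"
  shows "(2 :: 'p::prime_card mod_ring) \<noteq> 0"
proof
  assume "(2 :: 'p mod_ring) = 0"
  hence "CARD('p) dvd 2" using of_nat_0_mod_ring_dvd[of 2, where 'a = 'p] by simp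
  hence "CARD('p) = 2" using prime_card[where 'a = 'p] by (metis primes_dvd_imp_eq two_is_prime_nat)
  thus False using assms by simp
qed

section \<open>Polarisation and the squared Walsh transform\<close>

context finite_ext
begin

abbreviation lin_map :: "(nat \<Rightarrow> 'p mod_ring) \<Rightarrow> 'k \<Rightarrow> 'k" where
  "lin_map a \<equiv> frob_act (quad_poly n a)"

abbreviation quad :: "(nat \<Rightarrow> 'p mod_ring) \<Rightarrow> 'k \<Rightarrow> 'p mod_ring" where
  "quad a \<equiv> quad_fun n a"

lemma quad_eq: "quad a x = (\<Sum>i=0..n div 2. a i * tr (x * x ^ (p ^ i)))"
  by (simp add: quad_fun_def)

lemma lin_map_eq:
  "lin_map a z = (\<Sum>i=0..n div 2. emb (a i) * z ^ (p ^ i) + emb (a i) * z ^ (p ^ (n - i)))"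
  by (simp add: quad_poly_def power_p_mod)

text \<open>The trace is Frobenius-invariant: raising to the power p^(n-i) moves all of Frobenius to
  the other factor.\<close>

lemma tr_adjoint:
  assumes "i \<le> n"
  shows "tr (y ^ (p ^ i) * z) = tr (y * z ^ (p ^ (n - i)))"
proof -
  have "tr (y ^ (p ^ i) * z) = tr ((y ^ (p ^ i) * z) ^ (p ^ (n - i)))"
    by (rule tr_power[symmetric])
  also have "(y ^ (p ^ i) * z) ^ (p ^ (n - i)) = y ^ (p ^ n) * z ^ (p ^ (n - i))"
    using assms by (simp add: power_mult_distrib flip: power_mult power_add)
  finally show ?thesis by simp
qed

text \<open>Expanding the quadratic form leaves two cross terms for each i; the adjoint rule moves
  both to the shape y times an expression in z, which is \<open>lin_map a z\<close>.\<close>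

lemma quad_add: "quad a (y + z) = quad a y + quad a z + tr (y * lin_map a z)"
proof -
  have "quad a (y + z) = (\<Sum>i=0..n div 2. a i * tr (y * y ^ (p ^ i)) + a i * tr (z * z ^ (p ^ i))
      + (a i * tr (y * z ^ (p ^ i)) + a i * tr (y ^ (p ^ i) * z)))"
    unfolding quad_eq by (intro sum.cong refl) (simp add: frob_add algebra_simps)
  also have "\<dots> = (\<Sum>i=0..n div 2. a i * tr (y * y ^ (p ^ i)) + a i * tr (z * z ^ (p ^ i))
      + tr (y * (emb (a i) * z ^ (p ^ i) + emb (a i) * z ^ (p ^ (n - i)))))"
  proof (intro sum.cong refl arg_cong2[of _ _ _ _ "(+)"])
    fix i assume "i \<in> {0..n div 2}"
    hence "i \<le> n" using div_le_dividend[of n 2] by simp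
    moreover have "y * (emb (a i) * z ^ (p ^ i) + emb (a i) * z ^ (p ^ (n - i)))
        = emb (a i) * (y * z ^ (p ^ i)) + emb (a i) * (y * z ^ (p ^ (n - i)))"
      by (simp add: algebra_simps)
    ultimately show "a i * tr (y * z ^ (p ^ i)) + a i * tr (y ^ (p ^ i) * z)
        = tr (y * (emb (a i) * z ^ (p ^ i) + emb (a i) * z ^ (p ^ (n - i))))"
      by (simp add: tr_adjoint)
  qed
  also have "\<dots> = quad a y + quad a z + tr (y * lin_map a z)"
    unfolding quad_eq lin_map_eq sum_distrib_left[of y] tr_sum by (simp only: sum.distrib)
  finally show ?thesis .
qed

lemma quad_0 [simp]: "quad a 0 = 0"
  by (simp add: quad_eq)

lemma quad_uminus:
  assumes "odd p"
  shows "quad a (- z) = quad a z"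
  using assms by (simp add: quad_eq power_minus_odd)

text \<open>The form is even, so polarisation at -z and z gives 0 = 2 Q(z) when z lies in the
  radical.\<close>

lemma quad_radical:
  assumes "odd p" "lin_map a z = 0"
  shows "quad a z = 0"
proof -
  have two: "(2 :: 'p mod_ring) \<noteq> 0" using assms(1) by (simp add: two_neq_0_mod_ring)
  have "0 = quad a (- z + z)" by simp
  also have "\<dots> = 2 * quad a z"
    unfolding quad_add using assms by (simp add: quad_uminus)
  finally show ?thesis using two by simp
qed

lemma sum_tr_char: "(\<Sum>y\<in>UNIV. add_char (tr (y * c))) = (if c = 0 then of_nat (p ^ n) else 0)"
proof (cases "c = 0")
  case False
  obtain x where "tr x \<noteq> 0" using tr_nontrivial by blast
  hence "\<not> (\<forall>y\<in>UNIV. tr (y * c) = 0)" using False by (intro notI) (metis UNIV_I nonzero_divide_eq_eq)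
  thus ?thesis using False
    by (subst sum_add_char) (auto simp: ring_distribs)
qed (simp add: card_k)

lemma walsh_square:
  assumes "odd p"
  shows "of_real ((cmod (walsh n (quad a) b))\<^sup>2)
    = (if \<forall>z\<in>frob_ker (quad_poly n a). tr (b * z) = 0
       then of_nat (p ^ n * card (frob_ker (quad_poly n a))) else (0 :: complex))"
proof -
  define g where "g x = quad a x - tr (b * x)" for x
  have g_add: "g (y + z) = g y + g z + tr (y * lin_map a z)" for y z
    by (simp add: g_def quad_add algebra_simps)
  have walsh: "walsh n (quad a) b = (\<Sum>x\<in>UNIV. add_char (g x))"
    by (simp add: walsh_add_char g_def)
  have "of_real ((cmod (walsh n (quad a) b))\<^sup>2) = walsh n (quad a) b * cnj (walsh n (quad a) b)"
    by (rule complex_norm_square)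
  also have "\<dots> = (\<Sum>y\<in>UNIV. \<Sum>x\<in>UNIV. add_char (g x) * add_char (- g y))"
    by (simp add: walsh sum_product add_char_uminus) (rule sum.swap)
  \<comment> \<open>Substituting x = y + z cancels g y and leaves a sum over y whose exponent is
    linear in y.\<close>
  also have "\<dots> = (\<Sum>y\<in>UNIV. \<Sum>z\<in>UNIV. add_char (g (y + z)) * add_char (- g y))"
  proof (rule sum.cong[OF refl])
    fix y
    show "(\<Sum>x\<in>UNIV. add_char (g x) * add_char (- g y)) = (\<Sum>z\<in>UNIV. add_char (g (y + z)) * add_char (- g y))"
      by (rule sum.reindex_bij_witness[of _ "\<lambda>z. y + z" "\<lambda>x. x - y"]) auto
  qed
  also have "\<dots> = (\<Sum>y\<in>UNIV. \<Sum>z\<in>UNIV. add_char (g z) * add_char (tr (y * lin_map a z)))"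
    by (intro sum.cong refl) (simp add: g_add flip: add_char_add)
  also have "\<dots> = (\<Sum>z\<in>UNIV. add_char (g z) * (\<Sum>y\<in>UNIV. add_char (tr (y * lin_map a z))))"
    by (subst sum.swap) (simp add: sum_distrib_left)
  \<comment> \<open>Orthogonality in y keeps exactly the z killed by \<open>lin_map a\<close>; there
    the quadratic part vanishes, leaving only the trace term.\<close>
  also have "\<dots> = (\<Sum>z\<in>frob_ker (quad_poly n a). add_char (g z) * of_nat (p ^ n))"
    unfolding sum_tr_char by (rule sum.mono_neutral_cong_right) (auto simp: frob_ker_def)
  also have "\<dots> = of_nat (p ^ n) * (\<Sum>z\<in>frob_ker (quad_poly n a). add_char (- tr (b * z)))"
    by (simp add: sum_distrib_left mult.commute g_def frob_ker_def quad_radical[OF assms])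
  also have "(\<Sum>z\<in>frob_ker (quad_poly n a). add_char (- tr (b * z)))
      = (if \<forall>z\<in>frob_ker (quad_poly n a). - tr (b * z) = 0
         then of_nat (card (frob_ker (quad_poly n a))) else 0)"
    by (rule sum_add_char) (auto simp: frob_ker_def frob_act_arg_add frob_act_arg_diff ring_distribs)
  finally show ?thesis by simp
qed

text \<open>With d the degree of the gcd, the kernel has p^d elements, so every squared Walsh value
  is 0 or p^(n+d).\<close>

lemma plateaued_quad_iff:
  assumes "odd p"
  shows "plateaued n s (quad a) \<longleftrightarrow> s = degree (gcd (quad_poly n a) (cyc n))"
proof -
  define d where "d = degree (gcd (quad_poly n a) (cyc n))"
  have "d \<le> degree (cyc n :: 'p mod_ring poly)"
    unfolding d_def by (rule dvd_imp_degree_le) (use cyc_nz[OF n_pos] in auto)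
  hence d: "d \<le> n" by (simp add: degree_cyc[OF n_pos])
  have p1: "real p > 1" using prime_gt_1_nat[OF prime_p] by simp
  have val: "cmod (walsh n (quad a) b) = real p powr ((real n + real d) / 2)"
    if "\<forall>z\<in>frob_ker (quad_poly n a). tr (b * z) = 0" for b
  proof -
    have "complex_of_real ((cmod (walsh n (quad a) b))\<^sup>2) = of_real (real p ^ (n + d))"
      using walsh_square[OF assms, of a b] that by (simp add: card_frob_ker d_def power_add)
    hence "(cmod (walsh n (quad a) b))\<^sup>2 = real p ^ (n + d)"
      by (simp only: of_real_eq_iff)
    also have "\<dots> = (real p powr ((real n + real d) / 2))\<^sup>2"
      using p1 by (simp add: power2_eq_square powr_realpow[symmetric] flip: powr_add)
    finally show ?thesis by (rule power2_eq_imp_eq) auto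
  qed
  have zero: "walsh n (quad a) b = 0"
    if "\<not> (\<forall>z\<in>frob_ker (quad_poly n a). tr (b * z) = 0)" for b
    using walsh_square[OF assms, of a b] that by (simp split: if_splits)
  show ?thesis
    unfolding d_def[symmetric]
  proof
    assume "plateaued n s (quad a)"
    \<comment> \<open>At b = 0 the trace condition holds trivially, so this Walsh value is nonzero
      and determines s.\<close>
    hence "cmod (walsh n (quad a) 0) \<in> {0, real p powr ((real n + real s) / 2)}"
      by (simp add: plateaued_def)
    moreover have "cmod (walsh n (quad a) 0) = real p powr ((real n + real d) / 2)"
      by (rule val) simp
    ultimately have "real p powr ((real n + real d) / 2) = real p powr ((real n + real s) / 2)"
      using p1 by auto
    thus "s = d" using p1 by (simp add: powr_inj)
  next
    assume "s = d"
    thus "plateaued n s (quad a)"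
      unfolding plateaued_def using d val zero by (auto simp: card_p) 
  qed
qed

text \<open>Tuples are grouped by n minus the gcd degree, which lies between 0 and n, and then
  replaced by the symmetric residues they parametrise.\<close>

lemma gf_num_plateaued:
  assumes "odd p" "odd n"
  shows "(\<Sum>t=0..n. monom (int (num_plateaued tp tk n (n - t))) t) = sym_gf n (cyc n :: 'p mod_ring poly)"
proof -
  let ?E = "{0..n div 2} \<rightarrow>\<^sub>E (UNIV :: 'p mod_ring set)"
  let ?d = "\<lambda>A. degree (gcd A (cyc n :: 'p mod_ring poly))"
  have two: "(2 :: 'p mod_ring) \<noteq> 0" using assms(1) by (simp add: two_neq_0_mod_ring)
  have d: "?d A \<le> n" for A
  proof -
    have "?d A \<le> degree (cyc n :: 'p mod_ring poly)"
      by (rule dvd_imp_degree_le) (use cyc_nz[OF n_pos] in auto)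
    thus ?thesis by (simp add: degree_cyc[OF n_pos])
  qed
  have fin: "finite ?E" by (intro finite_PiE) auto
  have "(\<Sum>t=0..n. monom (int (num_plateaued tp tk n (n - t))) t)
      = (\<Sum>t=0..n. \<Sum>a\<in>{a \<in> ?E. n - ?d (quad_poly n a) = t}. monom 1 (n - ?d (quad_poly n a)))"
  proof (intro sum.cong refl)
    fix t assume t: "t \<in> {0..n}"
    have "{a \<in> ?E. plateaued n (n - t) (quad a)} = {a \<in> ?E. n - ?d (quad_poly n a) = t}"
    proof (intro Collect_cong conj_cong refl)
      fix a show "plateaued n (n - t) (quad a) \<longleftrightarrow> n - ?d (quad_poly n a) = t"
        using plateaued_quad_iff[OF assms(1), of "n - t" a] d[of "quad_poly n a"] t by auto
    qed
    hence "monom (int (num_plateaued tp tk n (n - t))) t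
        = (\<Sum>a\<in>{a \<in> ?E. n - ?d (quad_poly n a) = t}. monom (1::int) t)"
      by (simp add: num_plateaued_def of_nat_monom mult_monom)
    thus "monom (int (num_plateaued tp tk n (n - t))) t
        = (\<Sum>a\<in>{a \<in> ?E. n - ?d (quad_poly n a) = t}. monom 1 (n - ?d (quad_poly n a)))"
      by simp
  qed
  also have "\<dots> = (\<Sum>a\<in>?E. monom 1 (n - ?d (quad_poly n a)))"
    by (rule sum.group) (use fin in auto)
  also have "\<dots> = (\<Sum>A\<in>sym_res n 1 (cyc n). monom 1 (n - ?d A))"
    by (rule sum.reindex_bij_betw[OF bij_betw_quad_poly[OF assms(2) two]])
  finally show ?thesis by (simp add: sym_gf_def degree_cyc[OF n_pos])
qed

end

section \<open>Separability of x^m - 1 and extraction of p-power roots\<close>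

lemma cyc_square_dvd:
  fixes d :: "'a::field_gcd poly"
  assumes "d * d dvd cyc m" "(of_nat m :: 'a) \<noteq> 0"
  shows "is_unit d"
proof -
  have m: "m > 0" using assms(2) by (cases m) auto
  obtain k where k: "cyc m = d * d * k" using assms(1) by (elim dvdE)
  have "pderiv (cyc m) = d * (d * pderiv k + 2 * pderiv d * k)"
    unfolding k by (simp add: pderiv_mult algebra_simps)
  hence "d dvd pderiv (cyc m)" by simp
  \<comment> \<open>For f = x^m - 1 the combination x f' - m f is the constant m, a unit, and d
    divides both f and f'.\<close>
  hence "d dvd monom 1 1 * pderiv (cyc m)" by (rule dvd_mult)
  also have "monom 1 1 * pderiv (cyc m) = monom (of_nat m :: 'a) m"
    using m by (simp add: cyc_def pderiv_diff pderiv_monom mult_monom)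
  finally have "d dvd monom (of_nat m) m" .
  moreover have "d dvd smult (of_nat m) (cyc m)"
    using assms(1) dvd_mult_left dvd_smult by blast
  ultimately have "d dvd monom (of_nat m) m - smult (of_nat m) (cyc m)" by (rule dvd_diff)
  also have "monom (of_nat m) m - smult (of_nat m) (cyc m) = [:of_nat m :: 'a:]"
    by (simp add: cyc_def smult_diff_right smult_monom)
  finally have "d dvd [:of_nat m:]" .
  moreover have "is_unit [:of_nat m :: 'a:]"
    using assms(2) by (simp add: is_unit_const_poly_iff dvd_field_iff)
  ultimately show ?thesis by (rule dvd_unit_imp_unit)
qed

lemma coprime_of_mult_dvd_cyc:
  fixes a b :: "'a::field_gcd poly"
  assumes "a * b dvd cyc m" "(of_nat m :: 'a) \<noteq> 0"
  shows "coprime a b"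
proof (rule coprimeI)
  fix d assume "d dvd a" "d dvd b"
  hence "d * d dvd cyc m" using assms(1) by (meson dvd_trans mult_dvd_mono)
  thus "is_unit d" using assms(2) by (rule cyc_square_dvd)
qed

text \<open>A p-power q acts additively, so (A - B)^q = A^q - B^q; oddness of q settles the
  sign.\<close>

lemma power_prime_char_inject:
  fixes A B :: "'p::prime_card mod_ring poly"
  assumes "q = CARD('p) ^ v" "odd q" "A ^ q = B ^ q"
  shows "A = B"
proof -
  have "(A + - B) ^ q = A ^ q + (- B) ^ q"
    by (rule freshmans_dream') (simp_all add: assms(1) prime_card)
  hence "(A - B) ^ q = 0" using assms(2,3) by simp
  thus ?thesis by simp
qed

lemma cyc_power:
  assumes "q = CARD('p) ^ v" "odd q"
  shows "(cyc m :: 'p::prime_card mod_ring poly) ^ q = cyc (m * q)"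
proof -
  have "(monom 1 m + - 1 :: 'p mod_ring poly) ^ q = monom 1 m ^ q + (- 1) ^ q"
    by (rule freshmans_dream') (simp_all add: assms(1) prime_card)
  thus ?thesis using assms(2) by (simp add: cyc_def monom_power)
qed

theorem theorem3:
  fixes p n v k :: nat
    and r :: "nat \<Rightarrow> 'p::prime_card mod_ring poly"
  assumes "p = CARD('p)" and "odd p"
    and "odd n"
    and "CARD('k::{field,finite}) = p ^ n"
    and "v = multiplicity p n"
    and "inj_on r {1..k}"
    and "\<And>i. i \<in> {1..k} \<Longrightarrow> prime_self_reciprocal (r i)"
    and "Polynomial.monom 1 n - 1 = [:-1, 1:] ^ (p ^ v) * (\<Prod>i=1..k. r i ^ (p ^ v))"
  shows "(\<forall>i\<in>{1..k}. even (Polynomial.degree (r i))) \<and>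
    (\<Sum>t=0..n. Polynomial.monom (int (num_plateaued TYPE('p) TYPE('k) n (n - t))) t) =
    (1 + (\<Sum>j=1..(p ^ v + 1) div 2. Polynomial.monom (int p ^ (j - 1) * (int p - 1)) (2 * j - 1))) *
    (\<Prod>i=1..k. 1 + (\<Sum>j=1..p ^ v.
       Polynomial.monom (int p ^ (Polynomial.degree (r i ^ j) div 2)
              - int p ^ ((Polynomial.degree (r i ^ j) - Polynomial.degree (r i)) div 2))
             (j * Polynomial.degree (r i))))"
proof -
  define q where "q = p ^ v"
  define L where "L = [:-1, 1 :: 'p mod_ring:]"
  have n: "n > 0" using assms(3) by (cases n) auto
  have two: "(2 :: 'p mod_ring) \<noteq> 0" using assms(1,2) by (simp add: two_neq_0_mod_ring)
  have q: "q = CARD('p) ^ v" "odd q" "q > 0"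
    using assms(1,2) by (simp_all add: q_def)
  interpret finite_ext p n "TYPE('p)" "TYPE('k)"
    by standard (use assms n in auto)
  have cyc: "cyc n = L ^ q * (\<Prod>i=1..k. r i ^ q)"
    unfolding cyc_def q_def L_def by (rule assms(8))
  \<comment> \<open>The part of n prime to p, for which x^m - 1 is separable.\<close>
  obtain m where m: "n = m * q" "\<not> p dvd m"
    using multiplicity_decompose'[of n p] n prime_p unfolding q_def assms(5)
    by (metis mult.commute neq0_conv not_prime_unit)
  \<comment> \<open>Since x^n - 1 = (x^m - 1)^q, the given factorisation is a q-th power. Its root
    factors the squarefree x^m - 1, whence the pairwise coprimality of x - 1 and the r_i.\<close>
  have "(L * (\<Prod>i=1..k. r i)) ^ q = cyc m ^ q"
    unfolding power_mult_distrib prod_power_distrib cyc_power[OF q(1,2)] cyc[unfolded m(1)] ..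
  from power_prime_char_inject[OF q(1,2) this] have cyc_m: "cyc m = L * (\<Prod>i=1..k. r i)" ..
  have of_nat_m: "(of_nat m :: 'p mod_ring) \<noteq> 0"
    using m(2) of_nat_0_mod_ring_dvd[of m, where 'a = 'p] by auto
  have cop_L: "coprime L (r i)" if "i \<in> {1..k}" for i
    using that by (intro coprime_of_mult_dvd_cyc[OF _ of_nat_m]) (auto simp: cyc_m intro: mult_dvd_mono)
  have cop_r: "coprime (r i) (r j)" if "i \<in> {1..k}" "j \<in> {1..k}" "i \<noteq> j" for i j
  proof (rule coprime_of_mult_dvd_cyc[OF _ of_nat_m])
    have "(\<Prod>l\<in>{i, j}. r l) dvd (\<Prod>l=1..k. r l)"
      using that by (intro prod_dvd_prod_subset) auto
    thus "r i * r j dvd cyc m" using that by (simp add: cyc_m)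
  qed
  have dvd_r: "r i ^ q dvd cyc n" if "i \<in> {1..k}" for i
    unfolding cyc by (intro dvd_mult dvd_prodI that) simp
  have dvd_L: "L ^ q dvd cyc n" by (simp add: cyc)
  have sign: "refl_sign 1 (r i)" if "i \<in> {1..k}" for i
    using assms(7)[OF that] by (rule prime_self_reciprocal_refl_sign)
  have "even (degree (r i))" if "i \<in> {1..k}" for i
  proof (rule even_degree_refl_sign[OF sign[OF that] _ assms(3) two])
    show "r i dvd cyc n" using dvd_r[OF that] q(3) by (meson dvd_power dvd_trans)
  qed
  moreover have "sym_gf n (cyc n :: 'p mod_ring poly) = sym_gf n (L ^ q) * (\<Prod>i=1..k. sym_gf n (r i ^ q))"
  proof -
    have nz: "r i ^ q \<noteq> 0" if "i \<in> {1..k}" for i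
      using dvd_r[OF that] cyc_nz[OF n] by (metis dvd_0_left_iff)
    have st: "r i ^ q dvd recip n (r i ^ q)" if "i \<in> {1..k}" for i
      using inv_stable_refl_sign[OF refl_sign_power[OF sign[OF that]] dvd_r[OF that] n]
      by (simp add: inv_stable_def)
    have st_L: "L ^ q dvd recip n (L ^ q)"
      using inv_stable_refl_sign[OF refl_sign_power[OF refl_sign_linear] dvd_L[unfolded L_def] n]
      by (simp add: inv_stable_def L_def)
    have prod: "sym_gf n (\<Prod>i=1..k. r i ^ q) = (\<Prod>i=1..k. sym_gf n (r i ^ q))
        \<and> (\<Prod>i=1..k. r i ^ q) dvd recip n (\<Prod>i=1..k. r i ^ q)"
      by (rule sym_gf_prod) (use cop_r nz st in auto)
    have cop: "coprime (L ^ q) (\<Prod>i=1..k. r i ^ q)"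
      using cop_L by (intro prod_coprime_right) simp
    have "L ^ q * (\<Prod>i=1..k. r i ^ q) \<noteq> 0"
      using cyc_nz[OF n, where 'a = "'p mod_ring"] unfolding cyc .
    hence nz: "L ^ q \<noteq> 0" "(\<Prod>i=1..k. r i ^ q) \<noteq> 0" by (auto simp del: power_eq_0_iff)
    show ?thesis
      unfolding cyc prod[THEN conjunct1, symmetric]
      by (rule sym_gf_mult[OF cop nz st_L prod[THEN conjunct2]])
  qed
  moreover have "sym_gf n (L ^ q) = 1 + (\<Sum>j=1..(q + 1) div 2. monom (int p ^ (j - 1) * (int p - 1)) (2 * j - 1))"
    using sym_gf_linear_power[OF dvd_L[unfolded L_def] q(2) assms(3) two] by (simp add: L_def)
  moreover have "sym_gf n (r i ^ q) = 1 + (\<Sum>j=1..q. monom (int p ^ (degree (r i ^ j) div 2)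
      - int p ^ ((degree (r i ^ j) - degree (r i)) div 2)) (j * degree (r i)))" if "i \<in> {1..k}" for i
    using sym_gf_prime_self_reciprocal[OF assms(7)[OF that] dvd_r[OF that] q(3) assms(3) two] cop_L[OF that]
    by (simp add: L_def)
  ultimately show ?thesis
    unfolding gf_num_plateaued[OF assms(2,3)] q_def by simp
qed

end
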